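(* Let $(\mathcal M,g)$ be a smooth Riemannian manifold, let $\gamma:[r,t]\to\mathcal M$ be a smooth trajectory with $x_\tau=\gamma(\tau)$ and $t>r$, and let $v(x_\tau,\tau)\in T_{x_\tau}\mathcal M$ be the instantaneous velocity field along $\gamma$. Define $$u(x_t,r,t)=\frac{1}{t-r}\int_r^t \mathcal P^{\gamma}_{\tau\to t}\big(v(x_\tau,\tau)\big)\,\mathrm d\tau\in T_{x_t}\mathcal M .$$ If $v(\cdot,\tau)$ is sufficiently smooth along $\gamma$, then $$u(x_t,r,t)=v(x_t,t)-(t-r)\,\nabla_{\dot\gamma(t)}u(x_t,r,t).$$
   Context: $\mathcal P^{\gamma}_{\tau\to t}:T_{x_\tau}\mathcal M\to T_{x_t}\mathcal M$ denotes parallel transport induced by the Levi-Civita connection of $g$ along $\gamma|_{[\tau,t]}$. The reference time $r<t$ is fixed (independent of $t$). $\dot\gamma(t)\in T_{x_t}\mathcal M$ is the trajectory velocity at time $t$. $u$ is regarded as a vector field along $\gamma$ (as the time $t$ varies, with $r$ fixed), and $\nabla_{\dot\gamma(t)}u(x_t,r,t)$ denotes its covariant derivative along $\gamma$ at time $t$, i.e. the covariant time derivative $\frac{D}{dt}u(x_t,r,t)$; in local coordinates its components are $\frac{d}{dt}u^k(x_t,r,t)+\Gamma^k_{ij}(x_t)\,\dot x^i(t)\,u^j(x_t,r,t)$, with $\Gamma^k_{ij}$ the Christoffel symbols of the Levi-Civita connection and summation over repeated indices. *)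

theory Defs
  imports "HOL-Analysis.Analysis"
begin

section \<open>Smooth maps between Euclidean spaces\<close>

primrec C_on ::
  "nat \<Rightarrow> ('a::euclidean_space \<Rightarrow> 'b::real_normed_vector) \<Rightarrow> 'a set \<Rightarrow> bool" where
  "C_on 0 f U \<longleftrightarrow> continuous_on U f"
| "C_on (Suc k) f U \<longleftrightarrow>
     (\<forall>x\<in>U. f differentiable (at x)) \<and> (\<forall>h. C_on k (\<lambda>x. frechet_derivative f (at x) h) U)"

text \<open>\<open>S\<close> need not be open: smoothness on an arbitrary set means that the map extends locally to a
  smooth map on an open set.  This is used for trajectories on compact intervals.\<close>

definition smooth_on :: "'a::euclidean_space set \<Rightarrow> ('a \<Rightarrow> 'b::real_normed_vector) \<Rightarrow> bool" where
  "smooth_on S f \<longleftrightarrow>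
     (\<forall>x\<in>S. \<exists>U h. open U \<and> x \<in> U \<and> (\<forall>k. C_on k h U) \<and> (\<forall>y\<in>U \<inter> S. h y = f y))"


section \<open>Smooth manifolds\<close>

text \<open>The values of the coordinate map of a chart are meaningful only on the domain of the chart.\<close>

type_synonym ('a, 'n) chart = "'a set \<times> ('a \<Rightarrow> real^'n)"

abbreviation cdom :: "('a, 'n) chart \<Rightarrow> 'a set" where
  "cdom c \<equiv> fst c"

abbreviation coord :: "('a, 'n) chart \<Rightarrow> 'a \<Rightarrow> real^'n" where
  "coord c \<equiv> snd c"

definition point_of :: "('a, 'n) chart \<Rightarrow> real^'n \<Rightarrow> 'a" where
  "point_of c = inv_into (cdom c) (coord c)"

definition is_chart :: "'a topology \<Rightarrow> ('a, 'n::finite) chart \<Rightarrow> bool" where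
  "is_chart M c \<longleftrightarrow>
     openin M (cdom c) \<and> open (coord c ` cdom c) \<and>
     homeomorphic_map (subtopology M (cdom c)) (top_of_set (coord c ` cdom c)) (coord c)"

definition transition :: "('a, 'n) chart \<Rightarrow> ('a, 'n) chart \<Rightarrow> real^'n \<Rightarrow> real^'n" where
  "transition c d = coord d \<circ> point_of c"

text \<open>The atlas is not required to be maximal.  Every smooth structure is represented by its maximal
  atlas, but also by any smaller smooth atlas contained in it.\<close>

definition smooth_atlas :: "'a topology \<Rightarrow> ('a, 'n::finite) chart set \<Rightarrow> bool" where
  "smooth_atlas M A \<longleftrightarrow>
     (\<forall>c\<in>A. is_chart M c) \<and> (\<Union>c\<in>A. cdom c) = topspace M \<and>
     (\<forall>c\<in>A. \<forall>d\<in>A. smooth_on (coord c ` (cdom c \<inter> cdom d)) (transition c d))"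

definition smooth_manifold :: "'a topology \<Rightarrow> ('a, 'n::finite) chart set \<Rightarrow> bool" where
  "smooth_manifold M A \<longleftrightarrow> Hausdorff_space M \<and> second_countable M \<and> smooth_atlas M A"


section \<open>Tangent vectors\<close>

text \<open>A tangent vector at \<open>p\<close> is given by its component vectors in all charts around \<open>p\<close>, related
  by the Jacobians of the transition maps.  It is set to 0 on all other charts, so that
  equality of tangent vectors is equality of functions and the vector space operations (and the
  integral) on the tangent space are the pointwise ones.\<close>

type_synonym ('a, 'n) tangent = "('a, 'n) chart \<Rightarrow> real^'n"

definition charts_at :: "('a, 'n) chart set \<Rightarrow> 'a \<Rightarrow> ('a, 'n) chart set" where
  "charts_at A p = {c \<in> A. p \<in> cdom c}"

definition tangent_space :: "('a, 'n::finite) chart set \<Rightarrow> 'a \<Rightarrow> ('a, 'n) tangent set" where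
  "tangent_space A p = {X.
     (\<forall>c\<in>charts_at A p. \<forall>d\<in>charts_at A p.
        X d = frechet_derivative (transition c d) (at (coord c p)) (X c)) \<and>
     (\<forall>c. c \<notin> charts_at A p \<longrightarrow> X c = 0)}"

text \<open>The coordinate vector \<open>\<partial>\<^sub>i\<close> of the chart \<open>c\<close> at \<open>p\<close>.\<close>

definition coord_vector ::
  "('a, 'n::finite) chart set \<Rightarrow> ('a, 'n) chart \<Rightarrow> 'a \<Rightarrow> 'n \<Rightarrow> ('a, 'n) tangent" where
  "coord_vector A c p i = (\<lambda>d. if d \<in> charts_at A p
     then frechet_derivative (transition c d) (at (coord c p)) (axis i 1) else 0)"


section \<open>Riemannian metrics and the Levi-Civita connection\<close>

type_synonym ('a, 'n) metric = "'a \<Rightarrow> ('a, 'n) tangent \<Rightarrow> ('a, 'n) tangent \<Rightarrow> real"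

text \<open>The matrix \<open>g\<^sub>i\<^sub>j\<close> of the metric in the chart \<open>c\<close>, as a function of the coordinates.\<close>

definition metric_matrix ::
  "('a, 'n::finite) chart set \<Rightarrow> ('a, 'n) metric \<Rightarrow> ('a, 'n) chart \<Rightarrow> real^'n \<Rightarrow> real^'n^'n" where
  "metric_matrix A g c x =
     (\<chi> i j. g (point_of c x) (coord_vector A c (point_of c x) i)
                            (coord_vector A c (point_of c x) j))"

definition riemannian_manifold ::
  "'a topology \<Rightarrow> ('a, 'n::finite) chart set \<Rightarrow> ('a, 'n) metric \<Rightarrow> bool" where
  "riemannian_manifold M A g \<longleftrightarrow> smooth_manifold M A \<and>
     (\<forall>p\<in>topspace M. \<forall>X\<in>tangent_space A p. \<forall>Y\<in>tangent_space A p.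
        g p X Y = g p Y X \<and> (X \<noteq> (\<lambda>c. 0) \<longrightarrow> 0 < g p X X) \<and>
        (\<forall>Z\<in>tangent_space A p. \<forall>a b.
           g p (\<lambda>c. a *\<^sub>R X c + b *\<^sub>R Y c) Z = a * g p X Z + b * g p Y Z)) \<and>
     (\<forall>c\<in>A. smooth_on (coord c ` cdom c) (metric_matrix A g c))"

definition metric_partial ::
  "('a, 'n::finite) chart set \<Rightarrow> ('a, 'n) metric \<Rightarrow> ('a, 'n) chart \<Rightarrow> real^'n \<Rightarrow>
     'n \<Rightarrow> 'n \<Rightarrow> 'n \<Rightarrow> real" where
  "metric_partial A g c x k i j =
     frechet_derivative (\<lambda>y. metric_matrix A g c y $ i $ j) (at x) (axis k 1)"

text \<open>The Christoffel symbols \<open>\<Gamma>\<^sup>k\<^sub>i\<^sub>j\<close> of the Levi-Civita connection: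
  half the sum over \<open>l\<close> of \<open>g\<^sup>k\<^sup>l (\<partial>\<^sub>i g\<^sub>j\<^sub>l + \<partial>\<^sub>j g\<^sub>i\<^sub>l - \<partial>\<^sub>l g\<^sub>i\<^sub>j)\<close>.\<close>

definition christoffel ::
  "('a, 'n::finite) chart set \<Rightarrow> ('a, 'n) metric \<Rightarrow> ('a, 'n) chart \<Rightarrow> real^'n \<Rightarrow>
     'n \<Rightarrow> 'n \<Rightarrow> 'n \<Rightarrow> real" where
  "christoffel A g c x k i j =
     (\<Sum>l\<in>UNIV. matrix_inv (metric_matrix A g c x) $ k $ l *
        (metric_partial A g c x i j l + metric_partial A g c x j i l
           - metric_partial A g c x l i j)) / 2"


section \<open>Vector fields along trajectories\<close>

definition smooth_trajectory ::
  "'a topology \<Rightarrow> ('a, 'n::finite) chart set \<Rightarrow> real set \<Rightarrow> (real \<Rightarrow> 'a) \<Rightarrow> bool" where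
  "smooth_trajectory M A S \<gamma> \<longleftrightarrow> continuous_map (top_of_set S) M \<gamma> \<and>
     (\<forall>c\<in>A. smooth_on {s \<in> S. \<gamma> s \<in> cdom c} (\<lambda>s. coord c (\<gamma> s)))"

text \<open>All time derivatives are taken within the time interval \<open>S\<close>, hence are one-sided at its end
  points.\<close>

definition velocity ::
  "('a, 'n::finite) chart set \<Rightarrow> real set \<Rightarrow> (real \<Rightarrow> 'a) \<Rightarrow> real \<Rightarrow> ('a, 'n) tangent" where
  "velocity A S \<gamma> t = (\<lambda>c. if c \<in> charts_at A (\<gamma> t)
     then vector_derivative (\<lambda>s. coord c (\<gamma> s)) (at t within S) else 0)"

definition vector_field_along ::
  "('a, 'n::finite) chart set \<Rightarrow> real set \<Rightarrow> (real \<Rightarrow> 'a) \<Rightarrow> (real \<Rightarrow> ('a, 'n) tangent) \<Rightarrow> bool" where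
  "vector_field_along A S \<gamma> X \<longleftrightarrow> (\<forall>s\<in>S. X s \<in> tangent_space A (\<gamma> s))"

definition continuous_along ::
  "('a, 'n::finite) chart set \<Rightarrow> real set \<Rightarrow> (real \<Rightarrow> 'a) \<Rightarrow> (real \<Rightarrow> ('a, 'n) tangent) \<Rightarrow> bool" where
  "continuous_along A S \<gamma> X \<longleftrightarrow>
     (\<forall>c\<in>A. continuous_on {s \<in> S. \<gamma> s \<in> cdom c} (\<lambda>s. X s c))"

text \<open>\<open>\<Gamma>\<^sup>k\<^sub>i\<^sub>j\<close> contracted with the velocity of the trajectory and a tangent vector.\<close>

definition connection_term ::
  "('a, 'n::finite) chart set \<Rightarrow> ('a, 'n) metric \<Rightarrow> real set \<Rightarrow> (real \<Rightarrow> 'a) \<Rightarrow> real \<Rightarrow>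
     ('a, 'n) tangent \<Rightarrow> ('a, 'n) tangent" where
  "connection_term A g S \<gamma> t X = (\<lambda>c. \<chi> k. \<Sum>i\<in>UNIV. \<Sum>j\<in>UNIV.
     christoffel A g c (coord c (\<gamma> t)) k i j * velocity A S \<gamma> t c $ i * X c $ j)"

text \<open>\<open>D\<close> is the covariant derivative of \<open>X\<close> along \<open>\<gamma>\<close> at time \<open>t\<close>: in each chart,
  \<open>D\<^sup>k\<close> is the derivative of \<open>X\<^sup>k\<close> plus the connection term.\<close>

definition has_covariant_derivative ::
  "('a, 'n::finite) chart set \<Rightarrow> ('a, 'n) metric \<Rightarrow> real set \<Rightarrow> (real \<Rightarrow> 'a) \<Rightarrow>
     (real \<Rightarrow> ('a, 'n) tangent) \<Rightarrow> ('a, 'n) tangent \<Rightarrow> real \<Rightarrow> bool" where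
  "has_covariant_derivative A g S \<gamma> X D t \<longleftrightarrow>
     D \<in> tangent_space A (\<gamma> t) \<and>
     (\<forall>c\<in>charts_at A (\<gamma> t).
        ((\<lambda>s. X s c) has_vector_derivative (D c - connection_term A g S \<gamma> t (X t) c))
          (at t within S))"

definition covariant_derivative ::
  "('a, 'n::finite) chart set \<Rightarrow> ('a, 'n) metric \<Rightarrow> real set \<Rightarrow> (real \<Rightarrow> 'a) \<Rightarrow>
     (real \<Rightarrow> ('a, 'n) tangent) \<Rightarrow> real \<Rightarrow> ('a, 'n) tangent" where
  "covariant_derivative A g S \<gamma> X t = (THE D. has_covariant_derivative A g S \<gamma> X D t)"

definition parallel_along ::
  "('a, 'n::finite) chart set \<Rightarrow> ('a, 'n) metric \<Rightarrow> real set \<Rightarrow> (real \<Rightarrow> 'a) \<Rightarrow>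
     (real \<Rightarrow> ('a, 'n) tangent) \<Rightarrow> bool" where
  "parallel_along A g S \<gamma> X \<longleftrightarrow> vector_field_along A S \<gamma> X \<and>
     (\<forall>s\<in>S. has_covariant_derivative A g S \<gamma> X (\<lambda>c. 0) s)"

text \<open>Only transport forward in time, \<open>a \<le> b\<close>, is covered.\<close>

definition parallel_transport ::
  "('a, 'n::finite) chart set \<Rightarrow> ('a, 'n) metric \<Rightarrow> (real \<Rightarrow> 'a) \<Rightarrow> real \<Rightarrow> real \<Rightarrow>
     ('a, 'n) tangent \<Rightarrow> ('a, 'n) tangent" where
  "parallel_transport A g \<gamma> a b w =
     (THE y. \<exists>X. parallel_along A g {a..b} \<gamma> X \<and> X a = w \<and> X b = y)"

text \<open>The average velocity \<open>u(x\<^sub>t, r, t)\<close>, where \<open>v p \<tau>\<close> is the instantaneous velocity at the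
  point \<open>p\<close> and time \<open>\<tau>\<close>.\<close>

definition average_velocity ::
  "('a, 'n::finite) chart set \<Rightarrow> ('a, 'n) metric \<Rightarrow> (real \<Rightarrow> 'a) \<Rightarrow>
     ('a \<Rightarrow> real \<Rightarrow> ('a, 'n) tangent) \<Rightarrow> real \<Rightarrow> real \<Rightarrow> ('a, 'n) tangent" where
  "average_velocity A g \<gamma> v r t = (\<lambda>c. (1 / (t - r)) *\<^sub>R
     integral {r..t} (\<lambda>\<tau>. parallel_transport A g \<gamma> \<tau> t (v (\<gamma> \<tau>) \<tau>) c))"

end

theory Submission
  imports Defs
begin

text \<open>Choose a frame \<open>E\<^sub>i\<close> of parallel fields along \<open>\<gamma>\<close> and write \<open>v(x\<^sub>\<tau>, \<tau>) = \<Sum> a\<^sub>i(\<tau>) E\<^sub>i(\<tau>)\<close>.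
  Parallel transport keeps the coefficients, so \<open>u(x\<^sub>t, r, t) = \<Sum> \<alpha>\<^sub>i(t) E\<^sub>i(t)\<close> where \<open>\<alpha>\<^sub>i(t)\<close> is the
  mean of \<open>a\<^sub>i\<close> over \<open>[r, t]\<close>.  The \<open>E\<^sub>i\<close> being parallel, the covariant derivative of \<open>u\<close> has the
  coefficients \<open>\<alpha>\<^sub>i' = (a\<^sub>i - \<alpha>\<^sub>i) / (t - r)\<close>, which is the claim.
  The frame exists because the parallel equation is a linear ODE in each chart; it has the same
  solutions in overlapping charts by the transformation law of the Christoffel symbols.  Parallel
  fields have constant length, which gives uniqueness and keeps the frame independent.\<close>

section \<open>Smooth maps\<close>

text \<open>The encoding shapes the proof. A tangent vector is a family over all charts, and
  \<open>has_covariant_derivative\<close> demands the derivative formula in every chart at the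
  point, so one local computation settles nothing until it is carried to the other charts. Since the
  Christoffel symbols are given by the metric formula, their transformation law must be derived, and
  it rests on the symmetry of second derivatives of transition maps. Both
  \<open>parallel_transport\<close> and \<open>covariant_derivative\<close> are definite
  descriptions, so each needs existence and uniqueness before it can be evaluated. The frame also
  separates the two roles of the end time in u: as upper limit of the integral and as the place to
  which vectors are transported. The integrals become scalar, and continuity of v suffices to
  differentiate them.\<close>

text \<open>Two applications of the mean value theorem, first in direction \<open>h\<close> and then
  in direction \<open>k\<close>, turn the quotient into \<open>f''\<close> at an intermediate point;
  continuity then gives the limit.\<close>

lemma second_difference_tendsto:
  fixes f :: "'a::real_normed_vector \<Rightarrow> real"
  assumes U: "open U" "x \<in> U"
    and f': "\<And>y. y \<in> U \<Longrightarrow> (f has_derivative f' y) (at y)"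
    and f'': "\<And>y. y \<in> U \<Longrightarrow> ((\<lambda>z. f' z h) has_derivative f'' y) (at y)"
    and cont: "continuous_on U (\<lambda>y. f'' y k)"
  shows "((\<lambda>s. (f (x + s *\<^sub>R h + s *\<^sub>R k) - f (x + s *\<^sub>R h) - f (x + s *\<^sub>R k) + f x) / s\<^sup>2)
           \<longlongrightarrow> f'' x k) (at_right 0)"
proof (rule tendstoI)
  fix e :: real assume e: "0 < e"
  from cont U have "isCont (\<lambda>y. f'' y k) x" by (simp add: continuous_on_eq_continuous_at)
  with e obtain d1 where d1: "d1 > 0" "\<And>y. dist y x < d1 \<Longrightarrow> dist (f'' y k) (f'' x k) < e"
    unfolding continuous_at_eps_delta by (metis dist_commute dist_real_def)
  from U obtain d2 where d2: "d2 > 0" "ball x d2 \<subseteq> U" using openE by blast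
  define d where "d = min d1 d2"
  have d: "d > 0" using d1 d2 by (simp add: d_def)
  \<comment> \<open>The summand 1 keeps \<open>N\<close> positive when \<open>h = k = 0\<close>; for
    \<open>s < d / N\<close> the whole parallelogram spanned by \<open>s h\<close> and
    \<open>s k\<close> stays within distance \<open>d\<close> of \<open>x\<close>.\<close>
  define N where "N = norm h + norm k + 1"
  have N: "N > 0" "norm h + norm k \<le> N" by (auto simp: N_def add_nonneg_pos)
  have "dist ((f (x + s *\<^sub>R h + s *\<^sub>R k) - f (x + s *\<^sub>R h) - f (x + s *\<^sub>R k) + f x) / s\<^sup>2) (f'' x k) < e"
    if s: "0 < s" "s < d / N" for s :: real
  proof -
    have near: "dist (x + a *\<^sub>R h + b *\<^sub>R k) x < d" if "0 \<le> a" "a \<le> s" "0 \<le> b" "b \<le> s" for a b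
    proof -
      have "dist (x + a *\<^sub>R h + b *\<^sub>R k) x \<le> norm (a *\<^sub>R h) + norm (b *\<^sub>R k)"
        using norm_triangle_ineq[of "a *\<^sub>R h" "b *\<^sub>R k"] by (simp add: dist_norm add.assoc)
      also have "\<dots> \<le> s * norm h + s * norm k"
        using that by (auto intro!: add_mono mult_right_mono)
      also have "\<dots> = s * (norm h + norm k)" by (simp add: algebra_simps)
      also have "\<dots> \<le> s * N" using s N by (intro mult_left_mono) auto
      also have "\<dots> < d" using s N by (simp add: pos_less_divide_eq)
      finally show ?thesis .
    qed
    have inU: "x + a *\<^sub>R h + b *\<^sub>R k \<in> U" if "0 \<le> a" "a \<le> s" "0 \<le> b" "b \<le> s" for a b
      using near[OF that] d2 by (auto simp: d_def dist_commute subset_eq)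
    define p where "p a b = x + a *\<^sub>R h + b *\<^sub>R k" for a b
    have D1: "((\<lambda>a. f (p a b)) has_real_derivative f' (p a b) h) (at a)"
      if "0 \<le> a" "a \<le> s" "0 \<le> b" "b \<le> s" for a b
    proof -
      have "((\<lambda>a. p a b) has_derivative (\<lambda>t. t *\<^sub>R h)) (at a)"
        unfolding p_def by (auto intro!: derivative_eq_intros)
      from has_derivative_compose[OF this f'[OF inU[OF that, folded p_def]]]
      have "((\<lambda>a. f (p a b)) has_derivative (\<lambda>t. f' (p a b) (t *\<^sub>R h))) (at a)" .
      moreover have "f' (p a b) (t *\<^sub>R h) = t * f' (p a b) h" for t
        using linear_scale[OF has_derivative_linear[OF f'[OF inU[OF that, folded p_def]]]] by simp
      ultimately show ?thesis
        by (simp add: has_field_derivative_def mult_commute_abs)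
    qed
    have D2: "((\<lambda>b. f' (p a b) h) has_real_derivative f'' (p a b) k) (at b)"
      if "0 \<le> a" "a \<le> s" "0 \<le> b" "b \<le> s" for a b
    proof -
      have "((\<lambda>b. p a b) has_derivative (\<lambda>t. t *\<^sub>R k)) (at b)"
        unfolding p_def by (auto intro!: derivative_eq_intros)
      from has_derivative_compose[OF this f''[OF inU[OF that, folded p_def]]]
      have "((\<lambda>b. f' (p a b) h) has_derivative (\<lambda>t. f'' (p a b) (t *\<^sub>R k))) (at b)" .
      moreover have "f'' (p a b) (t *\<^sub>R k) = t * f'' (p a b) k" for t
        using linear_scale[OF has_derivative_linear[OF f''[OF inU[OF that, folded p_def]]]] by simp
      ultimately show ?thesis
        by (simp add: has_field_derivative_def mult_commute_abs)
    qed
    \<comment> \<open>The mean value theorem is applied to the difference of \<open>f\<close> along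
      the two opposite sides in direction \<open>h\<close>.\<close>
    have "\<exists>a>0. a < s \<and> (f (p s s) - f (p s 0)) - (f (p 0 s) - f (p 0 0))
              = (s - 0) * (f' (p a s) h - f' (p a 0) h)"
      using s by (intro MVT2[where f = "\<lambda>a. f (p a s) - f (p a 0)"]) (auto intro!: DERIV_diff D1)
    then obtain a where a: "0 < a" "a < s"
      "(f (p s s) - f (p s 0)) - (f (p 0 s) - f (p 0 0)) = s * (f' (p a s) h - f' (p a 0) h)"
      by auto
    have "\<exists>b>0. b < s \<and> f' (p a s) h - f' (p a 0) h = (s - 0) * f'' (p a b) k"
      using s a by (intro MVT2[where f = "\<lambda>b. f' (p a b) h"]) (auto intro!: D2)
    then obtain b where b: "0 < b" "b < s" "f' (p a s) h - f' (p a 0) h = s * f'' (p a b) k"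
      by auto
    have "(f (x + s *\<^sub>R h + s *\<^sub>R k) - f (x + s *\<^sub>R h) - f (x + s *\<^sub>R k) + f x) / s\<^sup>2 = f'' (p a b) k"
      using a(3) b(3) s by (simp add: p_def power2_eq_square field_simps)
    moreover have "dist (f'' (p a b) k) (f'' x k) < e"
      using near[of a b] a b by (intro d1) (auto simp: p_def d_def)
    ultimately show ?thesis by simp
  qed
  then show "\<forall>\<^sub>F s in at_right 0.
     dist ((f (x + s *\<^sub>R h + s *\<^sub>R k) - f (x + s *\<^sub>R h) - f (x + s *\<^sub>R k) + f x) / s\<^sup>2) (f'' x k) < e"
    unfolding eventually_at_right_field using d N by (intro exI[of _ "d / N"]) auto
qed

text \<open>The second difference quotient does not change when \<open>h\<close> and
  \<open>k\<close> are exchanged, so its two limits coincide.\<close>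

lemma second_derivative_symmetric_real:
  fixes f :: "'a::real_normed_vector \<Rightarrow> real"
  assumes U: "open U" "x \<in> U"
    and f': "\<And>y. y \<in> U \<Longrightarrow> (f has_derivative f' y) (at y)"
    and f'': "\<And>y h. y \<in> U \<Longrightarrow> ((\<lambda>z. f' z h) has_derivative f'' y h) (at y)"
    and cont: "\<And>h k. continuous_on U (\<lambda>y. f'' y h k)"
  shows "f'' x h k = f'' x k h"
proof (rule tendsto_unique)
  show "((\<lambda>s. (f (x + s *\<^sub>R h + s *\<^sub>R k) - f (x + s *\<^sub>R h) - f (x + s *\<^sub>R k) + f x) / s\<^sup>2)
           \<longlongrightarrow> f'' x h k) (at_right 0)"
    by (rule second_difference_tendsto[OF U f' f'' cont])
  have "((\<lambda>s. (f (x + s *\<^sub>R k + s *\<^sub>R h) - f (x + s *\<^sub>R k) - f (x + s *\<^sub>R h) + f x) / s\<^sup>2)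
           \<longlongrightarrow> f'' x k h) (at_right 0)"
    by (rule second_difference_tendsto[OF U f' f'' cont])
  then show "((\<lambda>s. (f (x + s *\<^sub>R h + s *\<^sub>R k) - f (x + s *\<^sub>R h) - f (x + s *\<^sub>R k) + f x) / s\<^sup>2)
           \<longlongrightarrow> f'' x k h) (at_right 0)"
    by (simp add: algebra_simps)
qed simp

text \<open>The mean value theorem needs real values, hence the reduction to components. It is
  applied later to transition maps.\<close>

lemma second_derivative_symmetric:
  fixes f :: "'a::euclidean_space \<Rightarrow> 'b::euclidean_space"
  assumes U: "open U" "x \<in> U" and C: "C_on 2 f U"
  shows "frechet_derivative (\<lambda>y. frechet_derivative f (at y) h) (at x) k
       = frechet_derivative (\<lambda>y. frechet_derivative f (at y) k) (at x) h"
proof (rule euclidean_eqI)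
  fix b :: 'b assume "b \<in> Basis"
  have C': "\<And>y. y \<in> U \<Longrightarrow> f differentiable (at y)"
    "\<And>y h. y \<in> U \<Longrightarrow> (\<lambda>z. frechet_derivative f (at z) h) differentiable (at y)"
    "\<And>h k. continuous_on U (\<lambda>y. frechet_derivative (\<lambda>z. frechet_derivative f (at z) h) (at y) k)"
    using C by (auto simp: numeral_2_eq_2)
  show "frechet_derivative (\<lambda>y. frechet_derivative f (at y) h) (at x) k \<bullet> b
       = frechet_derivative (\<lambda>y. frechet_derivative f (at y) k) (at x) h \<bullet> b"
  proof (rule second_derivative_symmetric_real[OF U,
      where f = "\<lambda>y. f y \<bullet> b" and f' = "\<lambda>y h. frechet_derivative f (at y) h \<bullet> b"
        and f'' = "\<lambda>y h k. frechet_derivative (\<lambda>y. frechet_derivative f (at y) h) (at y) k \<bullet> b"])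
  qed (use C' in \<open>auto intro!: has_derivative_inner_left continuous_intros
         simp: frechet_derivative_works\<close>)
qed

section \<open>Locality of smoothness; derivatives on intervals\<close>

lemma C_on_cong:
  assumes "open U" "\<And>x. x \<in> U \<Longrightarrow> f x = g x" "C_on k f U"
  shows "C_on k g U"
  using assms(2,3)
proof (induction k arbitrary: f g)
  case 0
  then show ?case using continuous_on_cong by force
next
  case (Suc k)
  have eq: "frechet_derivative f (at x) = frechet_derivative g (at x)" if "x \<in> U" for x
    using Suc.prems that assms(1) by (intro frechet_derivative_transform_within_open[of f x U g]) auto
  have "g differentiable (at x)" if "x \<in> U" for x
  proof -
    have "(f has_derivative frechet_derivative f (at x)) (at x)"
      using Suc.prems that by (auto simp: frechet_derivative_works)
    then have "(g has_derivative frechet_derivative f (at x)) (at x)"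
      by (rule has_derivative_transform_within_open[OF _ assms(1) that]) (use Suc.prems in auto)
    then show ?thesis by (auto simp: differentiable_def)
  qed
  moreover have "C_on k (\<lambda>x. frechet_derivative g (at x) h) U" for h
    by (rule Suc.IH[of "\<lambda>x. frechet_derivative f (at x) h"]) (use Suc.prems eq in auto)
  ultimately show ?case by simp
qed

lemma C_on_subset: "C_on k f U \<Longrightarrow> V \<subseteq> U \<Longrightarrow> C_on k f V"
  by (induction k arbitrary: f) (auto intro: continuous_on_subset)

text \<open>Every condition in \<open>C_on\<close> is pointwise, so it can be checked on
  neighbourhoods. This assembles the local extensions that \<open>smooth_on\<close>
  provides.\<close>

lemma C_on_locally:
  assumes "\<And>x. x \<in> S \<Longrightarrow> \<exists>V. open V \<and> x \<in> V \<and> C_on k f V"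
  shows "C_on k f S"
  using assms
proof (induction k arbitrary: f)
  case 0
  have "continuous (at x within S) f" if "x \<in> S" for x
  proof -
    obtain V where "open V" "x \<in> V" "continuous_on V f" using 0[OF \<open>x \<in> S\<close>] by auto
    then show ?thesis by (simp add: continuous_at_imp_continuous_at_within continuous_on_eq_continuous_at)
  qed
  then show ?case by (simp add: continuous_on_eq_continuous_within)
next
  case (Suc k)
  have "C_on k (\<lambda>x. frechet_derivative f (at x) h) S" for h
    using Suc.prems by (intro Suc.IH) fastforce
  with Suc.prems show ?case by fastforce
qed

text \<open>Near a point of an open set, the local extension is the function itself.\<close>

lemma smooth_on_open_imp_C_on:
  assumes "open S" "smooth_on S f"
  shows "C_on k f S"
proof (rule C_on_locally)
  fix x assume "x \<in> S"
  with assms(2) obtain U h where "open U" "x \<in> U" "C_on k h U" "\<forall>y\<in>U \<inter> S. h y = f y"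
    unfolding smooth_on_def by metis
  then have "C_on k f (U \<inter> S)"
    using assms(1) by (intro C_on_cong[of "U \<inter> S" h f]) (auto intro: C_on_subset)
  then show "\<exists>V. open V \<and> x \<in> V \<and> C_on k f V"
    using \<open>open U\<close> \<open>x \<in> U\<close> \<open>x \<in> S\<close> assms(1) by (intro exI[of _ "U \<inter> S"]) auto
qed

lemma at_within_interval_neq_bot:
  fixes a b s :: real
  assumes "a < b" "s \<in> {a..b}"
  shows "at s within {a..b} \<noteq> bot"
  using assms by (auto simp: trivial_limit_within islimpt_Icc)

text \<open>\<open>S\<close> will be the set of times that the trajectory spends in one chart. The
  derivative of a local extension restricts to the one-sided derivative of \<open>f\<close>, which
  yields existence and continuity together.\<close>

lemma smooth_on_interval_derivative:
  fixes f :: "real \<Rightarrow> 'b::real_normed_vector"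
  assumes ab: "a < b" and S: "openin (top_of_set {a..b}) S" and f: "smooth_on S f"
  shows "s \<in> S \<Longrightarrow> (f has_vector_derivative vector_derivative f (at s within {a..b})) (at s within {a..b})"
    and "continuous_on S (\<lambda>s. vector_derivative f (at s within {a..b}))"
proof -
  have loc: "\<exists>V h'. open V \<and> s \<in> V \<and> continuous_on V h' \<and>
      (\<forall>y\<in>V \<inter> S. (f has_vector_derivative h' y) (at y within {a..b}))" if s: "s \<in> S" for s
  proof -
    from S obtain W where W: "open W" "S = {a..b} \<inter> W" by (auto simp: openin_open)
    from f s obtain U h where U: "open U" "s \<in> U" "C_on (Suc 0) h U" "\<forall>y\<in>U \<inter> S. h y = f y"
      unfolding smooth_on_def by metis
    let ?h' = "\<lambda>y. frechet_derivative h (at y) 1"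
    have "(f has_vector_derivative ?h' y) (at y within {a..b})" if y: "y \<in> U \<inter> W" "y \<in> S" for y
    proof -
      have hd: "(h has_derivative frechet_derivative h (at y)) (at y)"
        using U(3) y unfolding C_on.simps frechet_derivative_works by blast
      have "frechet_derivative h (at y) t = t *\<^sub>R ?h' y" for t
        using linear_scale[OF has_derivative_linear[OF hd], of t 1]
        unfolding real_scaleR_def mult_1_right .
      then have "frechet_derivative h (at y) = (\<lambda>t. t *\<^sub>R ?h' y)"
        by (rule ext)
      then have "(h has_derivative (\<lambda>t. t *\<^sub>R ?h' y)) (at y)"
        by (rule has_derivative_eq_rhs[OF hd])
      then have hv: "(h has_vector_derivative ?h' y) (at y within {a..b})"
        by (simp add: has_vector_derivative_def has_derivative_at_withinI)
      \<comment> \<open>\<open>S\<close> is relatively open, so points of \<open>{a..b}\<close>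
        inside this ball lie in \<open>S\<close>, where the extension agrees with
        \<open>f\<close>.\<close>
      obtain e where e: "e > 0" "ball y e \<subseteq> U \<inter> W"
        using y U W by (meson open_Int openE)
      show ?thesis
        by (rule has_vector_derivative_transform_within[OF hv e(1)])
           (use U W y e in \<open>auto simp: dist_commute subset_eq\<close>)
    qed
    with U W s show ?thesis
      by (intro exI[of _ "U \<inter> W"] exI[of _ ?h']) (auto intro: continuous_on_subset)
  qed
  have ne: "at s within {a..b} \<noteq> bot" if "s \<in> S" for s
    using at_within_interval_neq_bot[OF ab, of s] that openin_imp_subset[OF S] by auto
  show "(f has_vector_derivative vector_derivative f (at s within {a..b})) (at s within {a..b})"
    if "s \<in> S" for s
    using loc[OF that] that vector_derivative_within[OF ne[OF that]] by (metis IntI)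
  show "continuous_on S (\<lambda>s. vector_derivative f (at s within {a..b}))"
    unfolding continuous_on_eq_continuous_within
  proof
    fix s assume s: "s \<in> S"
    obtain V h' where V: "open V" "s \<in> V" "continuous_on V h'"
      "\<forall>y\<in>V \<inter> S. (f has_vector_derivative h' y) (at y within {a..b})" using loc[OF s] by auto
    have "continuous (at s within S) h'"
      using V by (simp add: continuous_at_imp_continuous_at_within continuous_on_eq_continuous_at)
    moreover obtain e where "e > 0" "ball s e \<subseteq> V" using V openE by blast
    ultimately show "continuous (at s within S) (\<lambda>s. vector_derivative f (at s within {a..b}))"
      using s by (elim continuous_transform_within[of s S h' e])
        (auto simp: V ne dist_commute subset_eq intro!: vector_derivative_within[symmetric])
  qed
qed

section \<open>Linear differential equations and matrices\<close>

text \<open>The solution is the sum of the Picard terms \<open>\<phi> (Suc k) s = \<integral>\<^sub>a\<^sup>s B \<phi> k\<close>.\<close>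

lemma linear_ode_solution:
  fixes B :: "real \<Rightarrow> ('a::banach \<Rightarrow>\<^sub>L 'a)"
  assumes ab: "a \<le> b" and B: "continuous_on {a..b} B"
  obtains X where "X a = w"
    "\<And>s. s \<in> {a..b} \<Longrightarrow> (X has_vector_derivative B s (X s)) (at s within {a..b})"
proof -
  have "bounded (B ` {a..b})"
    using B by (simp add: compact_continuous_image compact_imp_bounded)
  then obtain L where L: "L > 0" "\<And>s. s \<in> {a..b} \<Longrightarrow> norm (B s) \<le> L"
    by (auto simp: bounded_pos)
  define \<phi> where "\<phi> = rec_nat (\<lambda>s. w) (\<lambda>k f s. integral {a..s} (\<lambda>\<tau>. B \<tau> (f \<tau>)))"
  have \<phi>0: "\<phi> 0 s = w" and \<phi>Suc: "\<phi> (Suc k) s = integral {a..s} (\<lambda>\<tau>. B \<tau> (\<phi> k \<tau>))" for k s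
    by (simp_all add: \<phi>_def)
  have cont: "continuous_on {a..b} (\<phi> k)" for k
  proof (induction k)
    case (Suc k)
    have "(\<lambda>\<tau>. B \<tau> (\<phi> k \<tau>)) integrable_on {a..b}"
      by (intro integrable_continuous_real continuous_intros B Suc)
    then show ?case unfolding \<phi>Suc by (rule indefinite_integral_continuous_1)
  qed (simp add: \<phi>0)
  have deriv: "(\<phi> (Suc k) has_vector_derivative B s (\<phi> k s)) (at s within {a..b})"
    if "s \<in> {a..b}" for k s
    unfolding \<phi>Suc
    by (intro integral_has_vector_derivative continuous_intros B cont that)
  \<comment> \<open>The terms of the series of \<open>norm w * exp (L * (s - a))\<close>. Since
    \<open>m (Suc k)\<close> is the antiderivative of \<open>L * m k\<close> vanishing at
    \<open>a\<close>, the bound passes from \<open>k\<close> to \<open>Suc k\<close> by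
    integration.\<close>
  define m where "m k s = norm w * (L * (s - a)) ^ k / fact k" for k s
  have bound: "norm (\<phi> k s) \<le> m k s" if "s \<in> {a..b}" for k s
    using that
  proof (induction k arbitrary: s)
    case (Suc k)
    have "((\<lambda>\<tau>. L * m k \<tau>) has_integral m (Suc k) s - m (Suc k) a) {a..s}"
    proof (rule fundamental_theorem_of_calculus)
      fix x assume "x \<in> {a..s}"
      have "(m (Suc k) has_real_derivative L * m k x) (at x within {a..s})"
        unfolding m_def
        by (rule derivative_eq_intros refl | simp add: field_simps del: of_nat_Suc)+
      then show "(m (Suc k) has_vector_derivative L * m k x) (at x within {a..s})"
        by (simp add: has_real_derivative_iff_has_vector_derivative)
    qed (use Suc in auto)
    then have I: "((\<lambda>\<tau>. L * m k \<tau>) has_integral m (Suc k) s) {a..s}" by (simp add: m_def)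
    have "norm (\<phi> (Suc k) s) \<le> integral {a..s} (\<lambda>\<tau>. L * m k \<tau>)"
      unfolding \<phi>Suc
    proof (rule integral_norm_bound_integral)
      show "(\<lambda>\<tau>. B \<tau> (\<phi> k \<tau>)) integrable_on {a..s}"
        using Suc.prems
        by (intro integrable_continuous_real continuous_intros continuous_on_subset[OF B]
            continuous_on_subset[OF cont]) auto
      show "(\<lambda>\<tau>. L * m k \<tau>) integrable_on {a..s}" using I by blast
      fix x assume x: "x \<in> {a..s}"
      have "norm (B x (\<phi> k x)) \<le> norm (B x) * norm (\<phi> k x)" by (rule norm_blinfun)
      also have "\<dots> \<le> L * m k x"
        using x Suc.prems L by (intro mult_mono L Suc.IH) auto
      finally show "norm (B x (\<phi> k x)) \<le> L * m k x" .
    qed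
    then show ?case unfolding integral_unique[OF I] .
  qed (simp add: \<phi>0 m_def)
  \<comment> \<open>The additional factor \<open>L\<close> is there because \<open>K\<close>
    majorizes the derivatives \<open>B s (\<phi> k s)\<close>, uniformly in
    \<open>s\<close>.\<close>
  define K where "K k = L * (norm w * (L * (b - a)) ^ k / fact k)" for k
  have "summable (\<lambda>k. (L * (b - a)) ^ k /\<^sub>R fact k)"
    by (rule summable_exp_generic)
  then have "summable (\<lambda>k. (L * norm w) * ((L * (b - a)) ^ k /\<^sub>R fact k))"
    by (rule summable_mult)
  moreover have "(\<lambda>k. (L * norm w) * ((L * (b - a)) ^ k /\<^sub>R fact k)) = K"
    by (rule ext) (simp add: K_def divide_inverse)
  ultimately have sumK: "summable K" by (simp only:)
  have boundK: "norm (B s (\<phi> k s)) \<le> K k" if s: "s \<in> {a..b}" for k s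
  proof -
    have "norm (B s (\<phi> k s)) \<le> norm (B s) * norm (\<phi> k s)" by (rule norm_blinfun)
    also have "\<dots> \<le> L * m k s" using s L by (intro mult_mono L bound) auto
    also have "\<dots> \<le> K k" unfolding K_def m_def using s L ab
      by (intro mult_left_mono divide_right_mono power_mono) auto
    finally show ?thesis .
  qed
  \<comment> \<open>Derivatives of the Picard terms: the constant term contributes 0, so partial
    sums of \<open>f'\<close> lag one index behind those in \<open>unif\<close>. The shift is undone
    by \<open>eventually_sequentially_Suc\<close>.\<close>
  define f' where "f' n s = (case n of 0 \<Rightarrow> 0 | Suc k \<Rightarrow> B s (\<phi> k s))" for n s
  have f': "(\<phi> n has_vector_derivative f' n s) (at s within {a..b})" if "s \<in> {a..b}" for n s
    using deriv[OF that] by (cases n) (auto simp: f'_def \<phi>0[abs_def])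
  define g' where "g' s = (\<Sum>k. B s (\<phi> k s))" for s
  have unif: "uniform_limit {a..b} (\<lambda>n s. \<Sum>k<n. B s (\<phi> k s)) g' sequentially"
    unfolding g'_def by (rule Weierstrass_m_test[OF boundK sumK]) auto
  have "\<phi> n a = (if n = 0 then w else 0)" for n by (cases n) (auto simp: \<phi>0 \<phi>Suc)
  then have "(\<lambda>n. \<phi> n a) = (\<lambda>n. if n = 0 then w else 0)" by auto
  then have at_a: "(\<lambda>n. \<phi> n a) sums w" using sums_single[of 0 "\<lambda>_. w"] by simp
  \<comment> \<open>Termwise differentiation needs convergence at one point; at \<open>a\<close> all
    terms but the first vanish.\<close>
  have "\<exists>g. \<forall>x\<in>{a..b}. (\<lambda>n. \<phi> n x) sums (g x) \<and> (g has_derivative (\<lambda>h. h *\<^sub>R g' x)) (at x within {a..b})"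
  proof (rule has_derivative_series[where f' = "\<lambda>n s h. h *\<^sub>R f' n s" and x = a and l = w])
    show "(\<phi> n has_derivative (\<lambda>h. h *\<^sub>R f' n x)) (at x within {a..b})" if "x \<in> {a..b}" for n x
      using f'[OF that] by (simp add: has_vector_derivative_def)
    show "\<forall>\<^sub>F n in sequentially. \<forall>x\<in>{a..b}. \<forall>h. norm ((\<Sum>i<n. h *\<^sub>R f' i x) - h *\<^sub>R g' x) \<le> e * norm h"
      if "e > 0" for e
    proof -
      have "\<forall>\<^sub>F n in sequentially. \<forall>x\<in>{a..b}. norm ((\<Sum>i<n. B x (\<phi> i x)) - g' x) < e"
        using unif that by (simp add: uniform_limit_iff dist_norm)
      then have "\<forall>\<^sub>F n in sequentially. \<forall>x\<in>{a..b}. norm ((\<Sum>i<Suc n. f' i x) - g' x) < e"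
        by (simp add: sum.lessThan_Suc_shift f'_def del: sum.lessThan_Suc)
      then have "\<forall>\<^sub>F n in sequentially. \<forall>x\<in>{a..b}. norm ((\<Sum>i<n. f' i x) - g' x) < e"
        by (subst (asm) eventually_sequentially_Suc)
      then show ?thesis
      proof eventually_elim
        case (elim n)
        show ?case
        proof (intro ballI allI)
          fix x h assume "x \<in> {a..b}"
          have "norm ((\<Sum>i<n. h *\<^sub>R f' i x) - h *\<^sub>R g' x) = norm h * norm ((\<Sum>i<n. f' i x) - g' x)"
            by (metis norm_scaleR real_norm_def scaleR_diff_right scaleR_sum_right)
          also have "\<dots> \<le> norm h * e"
            using elim \<open>x \<in> {a..b}\<close> by (intro mult_left_mono) (auto intro: less_imp_le)
          finally show "norm ((\<Sum>i<n. h *\<^sub>R f' i x) - h *\<^sub>R g' x) \<le> e * norm h"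
            by (simp add: mult.commute)
        qed
      qed
    qed
    show "(\<lambda>n. \<phi> n a) sums w" by (rule at_a)
  qed (use ab in auto)
  then obtain X where X: "\<And>s. s \<in> {a..b} \<Longrightarrow> (\<lambda>n. \<phi> n s) sums X s"
    "\<And>s. s \<in> {a..b} \<Longrightarrow> (X has_derivative (\<lambda>h. h *\<^sub>R g' s)) (at s within {a..b})" by blast
  \<comment> \<open>\<open>B s\<close> is bounded linear and may be exchanged with the infinite
    sum.\<close>
  have "g' s = B s (X s)" if "s \<in> {a..b}" for s
    using bounded_linear.sums[OF blinfun.bounded_linear_right X(1)[OF that], of "B s"]
    by (simp add: g'_def sums_iff)
  then have "(X has_vector_derivative B s (X s)) (at s within {a..b})" if "s \<in> {a..b}" for s
    using X(2)[OF that] that by (simp add: has_vector_derivative_def)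
  moreover have "X a = w"
    using X(1)[of a] at_a ab by (auto intro: sums_unique2)
  ultimately show thesis using that by blast
qed

section \<open>Matrices and the product rule for quadratic forms\<close>

lemma continuous_on_det:
  fixes F :: "'a::topological_space \<Rightarrow> real^'n^'n"
  assumes "\<And>i j. continuous_on S (\<lambda>x. F x $ i $ j)"
  shows "continuous_on S (\<lambda>x. det (F x))"
  unfolding det_def by (intro continuous_intros assms)

lemma matrix_inv_inverse:
  fixes A :: "real^'n^'n"
  assumes "invertible A"
  shows "A ** matrix_inv A = mat 1" "matrix_inv A ** A = mat 1"
  using someI_ex[OF assms[unfolded invertible_def]] by (auto simp: matrix_inv_def)

text \<open>Column \<open>l\<close> of the inverse solves a linear system with right hand side
  \<open>axis l 1\<close>; Cramer's rule writes its entries as quotients of determinants.\<close>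

lemma continuous_on_matrix_inv:
  fixes F :: "'a::topological_space \<Rightarrow> real^'n^'n"
  assumes F: "\<And>i j. continuous_on S (\<lambda>x. F x $ i $ j)" and inv: "\<And>x. x \<in> S \<Longrightarrow> invertible (F x)"
  shows "continuous_on S (\<lambda>x. matrix_inv (F x) $ k $ l)"
proof -
  have eq: "matrix_inv (F x) $ k $ l
      = det (\<chi> i j. if j = k then axis l 1 $ i else F x $ i $ j) / det (F x)" if "x \<in> S" for x
  proof -
    have "F x *v (matrix_inv (F x) *v axis l 1) = axis l 1"
      using matrix_inv_inverse(1)[OF inv[OF that]]
      by (simp add: matrix_vector_mul_assoc)
    moreover have "det (F x) \<noteq> 0" using inv[OF that] by (simp add: invertible_det_nz)
    ultimately have "matrix_inv (F x) *v axis l 1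
        = (\<chi> k. det (\<chi> i j. if j = k then axis l 1 $ i else F x $ i $ j) / det (F x))"
      by (simp add: cramer)
    then have "(matrix_inv (F x) *v axis l 1) $ k
        = det (\<chi> i j. if j = k then axis l 1 $ i else F x $ i $ j) / det (F x)" by simp
    then show ?thesis by (simp only: matrix_vector_mult_basis column_def vec_lambda_beta)
  qed
  have "continuous_on S (\<lambda>x. if j = k then axis l 1 $ i else F x $ i $ j :: real)" for i j
    by (cases "j = k") (auto intro: F)
  then have "continuous_on S (\<lambda>x. det (\<chi> i j. if j = k then axis l 1 $ i else F x $ i $ j))"
    by (intro continuous_on_det) (simp only: vec_lambda_beta)
  moreover have "continuous_on S (\<lambda>x. det (F x))" using F by (rule continuous_on_det)
  moreover have "\<forall>x\<in>S. det (F x) \<noteq> 0" using inv by (simp add: invertible_det_nz)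
  ultimately have "continuous_on S (\<lambda>x. det (\<chi> i j. if j = k then axis l 1 $ i else F x $ i $ j) / det (F x))"
    by (rule continuous_on_divide)
  then show ?thesis by (rule continuous_on_eq) (rule eq[symmetric])
qed

lemma basis_expansion_axis: "(\<Sum>i\<in>UNIV. a $ i *\<^sub>R axis i 1) = (a :: real^'n)"
  using basis_expansion[of a] by (simp add: scalar_mult_eq_scaleR)

text \<open>Lets a frame be treated as the matrix of its columns, so that independence of the frame
  becomes invertibility.\<close>

lemma matrix_columns_mult:
  "(\<chi> k i. y i $ k) *v a = (\<Sum>i\<in>UNIV. a $ i *\<^sub>R (y i :: real^'m))"
  by (simp add: vec_eq_iff matrix_vector_mult_def mult.commute)

lemma bounded_bilinear_matrix_vector_mult:
  "bounded_bilinear ((*v) :: real^'n^'m \<Rightarrow> real^'n \<Rightarrow> real^'m)"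
  by (subst bilinear_conv_bounded_bilinear[symmetric])
    (auto simp: bilinear_def linear_iff vec_eq_iff matrix_vector_mult_def
       sum.distrib sum_distrib_left algebra_simps)

text \<open>Differentiates the metric on constant vectors, on vectors carried along by a Jacobian,
  and on parallel fields.\<close>

lemma has_derivative_quadratic_form:
  fixes F :: "'a::real_normed_vector \<Rightarrow> real^'n^'n"
  assumes "(F has_derivative F') (at x within S)"
    and "(u has_derivative u') (at x within S)" "(w has_derivative w') (at x within S)"
  shows "((\<lambda>y. u y \<bullet> (F y *v w y)) has_derivative
    (\<lambda>h. u' h \<bullet> (F x *v w x) + u x \<bullet> (F' h *v w x) + u x \<bullet> (F x *v w' h))) (at x within S)"
  by (rule has_derivative_eq_rhs[OF has_derivative_inner[OF assms(2)
        bounded_bilinear.FDERIV[OF bounded_bilinear_matrix_vector_mult assms(1,3)]]])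
    (auto simp: inner_add_right algebra_simps)

section \<open>Charts, tangent vectors and the metric\<close>

locale riemannian =
  fixes M :: "'a topology" and A :: "('a, 'n::finite) chart set" and g :: "('a, 'n) metric"
  assumes riem: "riemannian_manifold M A g"
begin

lemma chart: "c \<in> A \<Longrightarrow> is_chart M c"
  using riem by (simp add: riemannian_manifold_def smooth_manifold_def smooth_atlas_def)

lemma openin_cdom: "c \<in> A \<Longrightarrow> openin M (cdom c)"
  using chart by (simp add: is_chart_def)

lemma cdom_subset: "c \<in> A \<Longrightarrow> cdom c \<subseteq> topspace M"
  by (rule openin_subset[OF openin_cdom])

lemma chart_covers: "p \<in> topspace M \<Longrightarrow> \<exists>c. c \<in> charts_at A p"
proof -
  assume "p \<in> topspace M"
  moreover have "(\<Union>c\<in>A. cdom c) = topspace M"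
    using riem unfolding riemannian_manifold_def smooth_manifold_def smooth_atlas_def by blast
  ultimately show ?thesis unfolding charts_at_def by blast
qed

lemma point_of_coord:
  assumes "c \<in> A" "p \<in> cdom c"
  shows "point_of c (coord c p) = p"
proof -
  have "inj_on (coord c) (topspace (subtopology M (cdom c)))"
    using chart[OF assms(1)] unfolding is_chart_def
    by (blast dest: homeomorphic_imp_injective_map)
  then have "inj_on (coord c) (cdom c)"
    using cdom_subset[OF assms(1)] by (simp add: Int_absorb1)
  then show ?thesis
    unfolding point_of_def using assms(2) by (rule inv_into_f_f)
qed

lemma transition_coord:
  "c \<in> A \<Longrightarrow> p \<in> cdom c \<Longrightarrow> transition c d (coord c p) = coord d p"
  by (simp add: transition_def point_of_coord)

lemma open_coord_image:
  assumes "c \<in> A" "openin M V" "V \<subseteq> cdom c"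
  shows "open (coord c ` V)"
proof -
  have "open_map (subtopology M (cdom c)) (top_of_set (coord c ` cdom c)) (coord c)"
    and op: "open (coord c ` cdom c)"
    using chart[OF assms(1)] unfolding is_chart_def by (auto intro: homeomorphic_imp_open_map)
  moreover have "openin (subtopology M (cdom c)) V"
    using assms by (simp add: openin_open_subtopology openin_cdom)
  ultimately have "openin (top_of_set (coord c ` cdom c)) (coord c ` V)"
    by (simp add: open_map_def)
  then show ?thesis using op openin_open_trans by blast
qed

lemma open_overlap:
  "c \<in> A \<Longrightarrow> d \<in> A \<Longrightarrow> open (coord c ` (cdom c \<inter> cdom d))"
  by (rule open_coord_image) (auto intro: openin_cdom)

lemma C_on_transition:
  assumes "c \<in> A" "d \<in> A"
  shows "C_on k (transition c d) (coord c ` (cdom c \<inter> cdom d))"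
  using riem assms
  by (intro smooth_on_open_imp_C_on open_overlap)
    (auto simp: riemannian_manifold_def smooth_manifold_def smooth_atlas_def)

section \<open>Jacobians and second derivatives of transition maps\<close>

definition jac :: "('a, 'n) chart \<Rightarrow> ('a, 'n) chart \<Rightarrow> real^'n \<Rightarrow> real^'n \<Rightarrow> real^'n" where
  "jac c d x = frechet_derivative (transition c d) (at x)"

text \<open>\<open>h\<close> is the vector that the Jacobian acts on; the last argument is the
  direction of differentiation.\<close>

definition hess ::
  "('a, 'n) chart \<Rightarrow> ('a, 'n) chart \<Rightarrow> real^'n \<Rightarrow> real^'n \<Rightarrow> real^'n \<Rightarrow> real^'n" where
  "hess c d x h = frechet_derivative (\<lambda>y. jac c d y h) (at x)"

context
  fixes c d :: "('a, 'n) chart" and p :: 'a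
  assumes cd: "c \<in> charts_at A p" "d \<in> charts_at A p"
begin

lemma coord_in_overlap: "coord c p \<in> coord c ` (cdom c \<inter> cdom d)"
  using cd by (auto simp: charts_at_def)

lemma transition_has_derivative:
  "(transition c d has_derivative jac c d (coord c p)) (at (coord c p))"
  using C_on_transition[of c d "Suc 0"] cd coord_in_overlap
  by (auto simp: jac_def charts_at_def frechet_derivative_works)

lemma linear_jac: "linear (jac c d (coord c p))"
  by (rule has_derivative_linear[OF transition_has_derivative])

lemma jac_has_derivative:
  "((\<lambda>y. jac c d y h) has_derivative hess c d (coord c p) h) (at (coord c p))"
  using C_on_transition[of c d 2] cd coord_in_overlap
  by (auto simp: jac_def hess_def charts_at_def frechet_derivative_works numeral_2_eq_2)

lemma hess_symmetric: "hess c d (coord c p) h k = hess c d (coord c p) k h"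
  unfolding hess_def jac_def
  using cd coord_in_overlap C_on_transition open_overlap
  by (intro second_derivative_symmetric[of "coord c ` (cdom c \<inter> cdom d)"]) (auto simp: charts_at_def)

lemma linear_hess: "linear (hess c d (coord c p) h)"
  by (rule has_derivative_linear[OF jac_has_derivative])

end

text \<open>The chain rule. The maps themselves compose correctly only over the triple overlap,
  whose image in \<open>c\<close> is open.\<close>

lemma jac_cocycle:
  assumes "c \<in> charts_at A p" "d \<in> charts_at A p" "e \<in> charts_at A p"
  shows "jac d e (coord d p) (jac c d (coord c p) a) = jac c e (coord c p) a"
proof -
  have A: "c \<in> A" "d \<in> A" "e \<in> A" and p: "p \<in> cdom c" "p \<in> cdom d" "p \<in> cdom e"
    using assms by (auto simp: charts_at_def)
  let ?U = "coord c ` (cdom c \<inter> cdom d \<inter> cdom e)"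
  have "(transition d e has_derivative jac d e (coord d p)) (at (transition c d (coord c p)))"
    using transition_has_derivative[OF assms(2,3)] by (simp add: transition_coord A p)
  from has_derivative_compose[OF transition_has_derivative[OF assms(1,2)] this]
  have "((\<lambda>x. transition d e (transition c d x)) has_derivative
      (\<lambda>a. jac d e (coord d p) (jac c d (coord c p) a))) (at (coord c p))" .
  then have "(transition c e has_derivative
      (\<lambda>a. jac d e (coord d p) (jac c d (coord c p) a))) (at (coord c p))"
  proof (rule has_derivative_transform_within_open)
    show "open ?U" using A by (intro open_coord_image) (auto intro: openin_cdom)
  qed (use A p in \<open>auto simp: transition_coord\<close>)
  from has_derivative_unique[OF this transition_has_derivative[OF assms(1,3)]]
  show ?thesis by (rule fun_cong)
qed

lemma jac_refl:
  assumes "c \<in> charts_at A p"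
  shows "jac c c (coord c p) a = a"
proof -
  have A: "c \<in> A" "p \<in> cdom c" using assms by (auto simp: charts_at_def)
  have "(transition c c has_derivative (\<lambda>a. a)) (at (coord c p))"
    by (rule has_derivative_transform_within_open[OF has_derivative_ident open_overlap[OF A(1) A(1)]])
      (use A in \<open>auto simp: transition_coord\<close>)
  from has_derivative_unique[OF transition_has_derivative[OF assms assms] this]
  show ?thesis by (rule fun_cong)
qed

section \<open>Tangent spaces\<close>

lemma tangent_space_change:
  "X \<in> tangent_space A p \<Longrightarrow> c \<in> charts_at A p \<Longrightarrow> d \<in> charts_at A p
     \<Longrightarrow> X d = jac c d (coord c p) (X c)"
  unfolding tangent_space_def jac_def by blast

lemma tangent_space_outside:
  "X \<in> tangent_space A p \<Longrightarrow> c \<notin> charts_at A p \<Longrightarrow> X c = 0"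
  unfolding tangent_space_def by blast

text \<open>For a chart \<open>c\<close> at \<open>p\<close>, the inverse of the evaluation
  \<open>X \<mapsto> X c\<close> on the tangent space: one coordinate vector is spread to all
  charts.\<close>

definition tangent_of :: "('a, 'n) chart \<Rightarrow> 'a \<Rightarrow> real^'n \<Rightarrow> ('a, 'n) tangent" where
  "tangent_of c p a = (\<lambda>d. if d \<in> charts_at A p then jac c d (coord c p) a else 0)"

lemma tangent_of_in: "c \<in> charts_at A p \<Longrightarrow> tangent_of c p a \<in> tangent_space A p"
  by (auto simp: tangent_space_def tangent_of_def jac_cocycle jac_def[symmetric])

lemma tangent_of_same: "c \<in> charts_at A p \<Longrightarrow> tangent_of c p a c = a"
  by (simp add: tangent_of_def jac_refl)

text \<open>The Jacobians determine the components in all charts at \<open>p\<close> from those in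
  \<open>c\<close>, and on the remaining charts both families are 0. Equalities of tangent vectors
  are thus checked in a single chart.\<close>

lemma tangent_space_eqI:
  assumes "X \<in> tangent_space A p" "Y \<in> tangent_space A p" "c \<in> charts_at A p" "X c = Y c"
  shows "X = Y"
proof
  fix d
  show "X d = Y d"
    by (metis assms tangent_space_change tangent_space_outside)
qed

lemma tangent_space_sum:
  assumes "\<And>i. i \<in> I \<Longrightarrow> X i \<in> tangent_space A p"
  shows "(\<lambda>c. \<Sum>i\<in>I. a i *\<^sub>R X i c) \<in> tangent_space A p"
proof -
  have "(\<Sum>i\<in>I. a i *\<^sub>R X i d) = jac c d (coord c p) (\<Sum>i\<in>I. a i *\<^sub>R X i c)"
    if cd: "c \<in> charts_at A p" "d \<in> charts_at A p" for c d
  proof -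
    have "(\<Sum>i\<in>I. a i *\<^sub>R X i d) = (\<Sum>i\<in>I. a i *\<^sub>R jac c d (coord c p) (X i c))"
      by (intro sum.cong refl) (simp add: tangent_space_change[OF assms cd])
    then show ?thesis
      using linear_jac[OF cd] by (simp add: linear_sum linear_scale)
  qed
  moreover have "(\<Sum>i\<in>I. a i *\<^sub>R X i d) = 0" if "d \<notin> charts_at A p" for d
    by (intro sum.neutral) (simp add: tangent_space_outside[OF assms that])
  ultimately show ?thesis unfolding tangent_space_def jac_def[symmetric] by blast
qed

lemma tangent_space_lincomb:
  assumes "X \<in> tangent_space A p" "Y \<in> tangent_space A p"
  shows "(\<lambda>c. a *\<^sub>R X c + b *\<^sub>R Y c) \<in> tangent_space A p"
  using tangent_space_sum[of "{True, False}" "\<lambda>i. if i then X else Y" p "\<lambda>i. if i then a else b"] assms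
  by simp

lemma tangent_space_zero: "(\<lambda>c. 0) \<in> tangent_space A p"
  using tangent_space_sum[of "{}"] by simp

lemma coord_vector_eq: "coord_vector A c p i = tangent_of c p (axis i 1)"
  unfolding coord_vector_def tangent_of_def jac_def ..

lemma tangent_expand:
  assumes "X \<in> tangent_space A p" "c \<in> charts_at A p"
  shows "X = (\<lambda>d. \<Sum>i\<in>UNIV. X c $ i *\<^sub>R coord_vector A c p i d)"
  by (rule tangent_space_eqI[OF assms(1) _ assms(2)])
    (auto simp: coord_vector_eq tangent_of_same assms basis_expansion_axis
      intro!: tangent_space_sum tangent_of_in)

section \<open>The metric in coordinates\<close>

lemma
  assumes "p \<in> topspace M" "X \<in> tangent_space A p" "Y \<in> tangent_space A p"
  shows metric_symmetric: "g p X Y = g p Y X"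
    and metric_pos: "X \<noteq> (\<lambda>c. 0) \<Longrightarrow> 0 < g p X X"
    and metric_linear: "Z \<in> tangent_space A p \<Longrightarrow>
      g p (\<lambda>c. a *\<^sub>R X c + b *\<^sub>R Y c) Z = a * g p X Z + b * g p Y Z"
  using riem assms unfolding riemannian_manifold_def by blast+

lemma metric_sum:
  assumes "finite I" "p \<in> topspace M" "\<And>i. i \<in> I \<Longrightarrow> X i \<in> tangent_space A p" "Z \<in> tangent_space A p"
  shows "g p (\<lambda>c. \<Sum>i\<in>I. a i *\<^sub>R X i c) Z = (\<Sum>i\<in>I. a i * g p (X i) Z)"
  using assms(1,3)
proof (induction I)
  case empty
  then show ?case
    using metric_linear[OF assms(2) tangent_space_zero tangent_space_zero assms(4), of 0 0] by simp
next
  case (insert i I)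
  have "g p (\<lambda>c. a i *\<^sub>R X i c + 1 *\<^sub>R (\<Sum>i\<in>I. a i *\<^sub>R X i c)) Z
      = a i * g p (X i) Z + 1 * g p (\<lambda>c. \<Sum>i\<in>I. a i *\<^sub>R X i c) Z"
    using insert.prems assms by (intro metric_linear tangent_space_sum) auto
  then show ?case using insert by simp
qed

text \<open>It takes the coordinates \<open>x\<close> rather than a point, so that it can be
  differentiated in \<open>x\<close>.\<close>

definition gram :: "('a, 'n) chart \<Rightarrow> real^'n \<Rightarrow> real^'n \<Rightarrow> real^'n \<Rightarrow> real" where
  "gram c x a b = a \<bullet> (metric_matrix A g c x *v b)"

lemma linear_gram_left: "linear (\<lambda>a. gram c x a b)"
  by (simp add: gram_def linear_iff inner_add_left)

text \<open>Both arguments are expanded in coordinate vectors. Linearity is available in the first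
  argument, so symmetry moves the second one there and back.\<close>

lemma metric_eq_gram:
  assumes c: "c \<in> charts_at A p" and X: "X \<in> tangent_space A p" and Y: "Y \<in> tangent_space A p"
  shows "g p X Y = gram c (coord c p) (X c) (Y c)"
proof -
  have A: "c \<in> A" "p \<in> cdom c" using c by (auto simp: charts_at_def)
  then have p: "p \<in> topspace M" using cdom_subset by blast
  have V: "coord_vector A c p i \<in> tangent_space A p" for i
    unfolding coord_vector_eq by (rule tangent_of_in[OF c])
  have "g p X Y = (\<Sum>i\<in>UNIV. X c $ i * g p (coord_vector A c p i) Y)"
    by (subst tangent_expand[OF X c]) (intro metric_sum p V Y finite)
  also have "\<dots> = (\<Sum>i\<in>UNIV. X c $ i * g p Y (coord_vector A c p i))"
    by (intro sum.cong refl arg_cong2[of _ _ _ _ "(*)"] metric_symmetric p V Y)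
  also have "\<dots> = (\<Sum>i\<in>UNIV. X c $ i * (\<Sum>j\<in>UNIV. Y c $ j *
      g p (coord_vector A c p j) (coord_vector A c p i)))"
    by (subst tangent_expand[OF Y c], subst metric_sum) (auto intro: p V)
  also have "\<dots> = (\<Sum>i\<in>UNIV. X c $ i * (\<Sum>j\<in>UNIV. Y c $ j *
      g p (coord_vector A c p i) (coord_vector A c p j)))"
    by (intro sum.cong refl arg_cong2[of _ _ _ _ "(*)"] metric_symmetric p V)
  also have "\<dots> = gram c (coord c p) (X c) (Y c)"
    by (simp add: gram_def inner_vec_def matrix_vector_mult_def metric_matrix_def
        point_of_coord A mult.commute)
  finally show ?thesis .
qed

lemma gram_eq_metric:
  assumes "c \<in> charts_at A p"
  shows "gram c (coord c p) a b = g p (tangent_of c p a) (tangent_of c p b)"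
  using assms by (simp add: metric_eq_gram tangent_of_in tangent_of_same)

lemma
  assumes "c \<in> charts_at A p"
  shows gram_symmetric: "gram c (coord c p) a b = gram c (coord c p) b a"
    and gram_pos: "a \<noteq> 0 \<Longrightarrow> 0 < gram c (coord c p) a a"
proof -
  have p: "p \<in> topspace M" using assms cdom_subset[of c] by (auto simp: charts_at_def)
  show "gram c (coord c p) a b = gram c (coord c p) b a"
    unfolding gram_eq_metric[OF assms] by (intro metric_symmetric p tangent_of_in assms)
  assume "a \<noteq> 0"
  then have "tangent_of c p a \<noteq> (\<lambda>c. 0)"
    using tangent_of_same[OF assms, of a] by metis
  then show "0 < gram c (coord c p) a a"
    unfolding gram_eq_metric[OF assms] by (rule metric_pos[OF p tangent_of_in[OF assms] tangent_of_in[OF assms]])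
qed

text \<open>Both sides compute the same value of \<open>g p\<close>, in two charts.\<close>

lemma gram_change:
  assumes "c \<in> charts_at A p" "d \<in> charts_at A p"
  shows "gram c (coord c p) a b
       = gram d (coord d p) (jac c d (coord c p) a) (jac c d (coord c p) b)"
  unfolding gram_eq_metric[OF assms(1)]
  using assms by (simp add: metric_eq_gram[of d] tangent_of_in) (simp add: tangent_of_def)

text \<open>Positivity on \<open>a - a'\<close>. Vector identities can therefore be proved after
  pairing with an arbitrary \<open>b\<close>, which is the form in which the Koszul formula gives
  information.\<close>

lemma gram_nondegenerate:
  assumes "c \<in> charts_at A p" "\<And>b. gram c (coord c p) a b = gram c (coord c p) a' b"
  shows "a = a'"
proof (rule ccontr)
  assume "a \<noteq> a'"
  then have "0 < gram c (coord c p) (a - a') (a - a')" using gram_pos[OF assms(1)] by simp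
  also have "\<dots> = 0" using assms(2) by (simp add: linear_diff[OF linear_gram_left])
  finally show False by simp
qed

text \<open>A nonzero vector in the kernel would have length 0.\<close>

lemma invertible_metric_matrix:
  assumes "c \<in> charts_at A p"
  shows "invertible (metric_matrix A g c (coord c p))"
proof -
  have "x = 0" if "metric_matrix A g c (coord c p) *v x = 0" for x
    using gram_pos[OF assms, of x] that by (force simp: gram_def)
  then show ?thesis
    using invertible_left_inverse matrix_left_invertible_ker by blast
qed

lemma C_on_metric_matrix:
  assumes "c \<in> A"
  shows "C_on k (metric_matrix A g c) (coord c ` cdom c)"
  using riem assms open_overlap[OF assms assms]
  by (intro smooth_on_open_imp_C_on) (auto simp: riemannian_manifold_def)

section \<open>Transformation of the Christoffel symbols\<close>

definition metric_deriv :: "('a, 'n) chart \<Rightarrow> real^'n \<Rightarrow> real^'n \<Rightarrow> real^'n^'n" where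
  "metric_deriv c x = frechet_derivative (metric_matrix A g c) (at x)"

lemma metric_matrix_has_derivative:
  assumes "c \<in> charts_at A p"
  shows "(metric_matrix A g c has_derivative metric_deriv c (coord c p)) (at (coord c p))"
  using C_on_metric_matrix[of c "Suc 0"] assms
  by (auto simp: metric_deriv_def charts_at_def frechet_derivative_works)

text \<open>The derivative of the metric in direction \<open>h\<close>, with the coordinate vectors
  \<open>a\<close> and \<open>b\<close> held constant.\<close>

definition gram_deriv ::
  "('a, 'n) chart \<Rightarrow> real^'n \<Rightarrow> real^'n \<Rightarrow> real^'n \<Rightarrow> real^'n \<Rightarrow> real" where
  "gram_deriv c x h a b = a \<bullet> (metric_deriv c x h *v b)"

lemma metric_partial_eq:
  assumes "c \<in> charts_at A p"
  shows "metric_partial A g c (coord c p) k i j = metric_deriv c (coord c p) (axis k 1) $ i $ j"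
proof -
  have "((\<lambda>y. metric_matrix A g c y $ i $ j) has_derivative
      (\<lambda>h. metric_deriv c (coord c p) h $ i $ j)) (at (coord c p))"
    by (intro bounded_linear.has_derivative[OF bounded_linear_vec_nth] metric_matrix_has_derivative assms)
  from frechet_derivative_at[OF this] show ?thesis
    by (simp add: metric_partial_def fun_eq_iff)
qed

text \<open>Connects the coordinate-free trilinear form with the partial derivatives from which
  \<open>christoffel\<close> is built.\<close>

lemma gram_deriv_expand:
  assumes "c \<in> charts_at A p"
  shows "gram_deriv c (coord c p) h a b
    = (\<Sum>i\<in>UNIV. \<Sum>j\<in>UNIV. \<Sum>l\<in>UNIV. metric_partial A g c (coord c p) i j l * h $ i * a $ j * b $ l)"
proof -
  have lin: "linear (metric_deriv c (coord c p))"
    by (rule has_derivative_linear[OF metric_matrix_has_derivative[OF assms]])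
  have "metric_deriv c (coord c p) h = metric_deriv c (coord c p) (\<Sum>i\<in>UNIV. h $ i *\<^sub>R axis i 1)"
    by (simp only: basis_expansion_axis)
  also have "\<dots> = (\<Sum>i\<in>UNIV. h $ i *\<^sub>R metric_deriv c (coord c p) (axis i 1))"
    by (simp only: linear_sum[OF lin] linear_scale[OF lin])
  finally have "metric_deriv c (coord c p) h $ j $ l
      = (\<Sum>i\<in>UNIV. h $ i * metric_partial A g c (coord c p) i j l)" for j l
    by (simp add: metric_partial_eq[OF assms])
  then have "gram_deriv c (coord c p) h a b = (\<Sum>j\<in>UNIV. \<Sum>l\<in>UNIV. \<Sum>i\<in>UNIV.
      metric_partial A g c (coord c p) i j l * h $ i * a $ j * b $ l)"
    by (simp add: gram_deriv_def inner_vec_def matrix_vector_mult_def sum_distrib_left sum_distrib_right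
        mult_ac)
  also have "\<dots> = (\<Sum>i\<in>UNIV. \<Sum>j\<in>UNIV. \<Sum>l\<in>UNIV.
      metric_partial A g c (coord c p) i j l * h $ i * a $ j * b $ l)"
    by (subst sum.swap, subst (2) sum.swap) (rule refl)
  finally show ?thesis .
qed

text \<open>The contraction in \<open>connection_term\<close>, detached from the trajectory:
  position, direction and vector are free.\<close>

definition christoffel_form ::
  "('a, 'n) chart \<Rightarrow> real^'n \<Rightarrow> real^'n \<Rightarrow> real^'n \<Rightarrow> real^'n" where
  "christoffel_form c x h a = (\<chi> k. \<Sum>i\<in>UNIV. \<Sum>j\<in>UNIV. christoffel A g c x k i j * h $ i * a $ j)"

lemma linear_christoffel_form: "linear (christoffel_form c x h)"
  by (auto simp: linear_iff christoffel_form_def vec_eq_iff sum.distrib sum_distrib_left algebra_simps)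

text \<open>The Koszul formula for coordinate vector fields.\<close>

lemma gram_christoffel_form:
  assumes c: "c \<in> charts_at A p"
  shows "gram c (coord c p) (christoffel_form c (coord c p) h a) b
    = (gram_deriv c (coord c p) h a b + gram_deriv c (coord c p) a h b - gram_deriv c (coord c p) b h a) / 2"
proof -
  let ?x = "coord c p"
  let ?G = "metric_matrix A g c ?x"
  let ?m = "metric_partial A g c ?x"
  \<comment> \<open>Contracted Christoffel symbols of the first kind (index lowered). Raising the
    index applies the inverse matrix, which the pairing by \<open>gram\<close> cancels
    again.\<close>
  define K :: "real^'n" where "K = (\<chi> l. \<Sum>i\<in>UNIV. \<Sum>j\<in>UNIV. (?m i j l + ?m j i l - ?m l i j) / 2 * h $ i * a $ j)"
  have "christoffel_form c ?x h a $ k = (matrix_inv ?G *v K) $ k" for k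
  proof -
    have "(matrix_inv ?G *v K) $ k = (\<Sum>l\<in>UNIV. \<Sum>i\<in>UNIV. \<Sum>j\<in>UNIV.
        matrix_inv ?G $ k $ l * ((?m i j l + ?m j i l - ?m l i j) / 2 * h $ i * a $ j))"
      by (simp add: K_def matrix_vector_mult_def sum_distrib_left)
    also have "\<dots> = (\<Sum>i\<in>UNIV. \<Sum>j\<in>UNIV. \<Sum>l\<in>UNIV.
        matrix_inv ?G $ k $ l * ((?m i j l + ?m j i l - ?m l i j) / 2 * h $ i * a $ j))"
      by (subst sum.swap, subst (2) sum.swap) (rule refl)
    also have "\<dots> = christoffel_form c ?x h a $ k"
      unfolding christoffel_form_def christoffel_def sum_divide_distrib sum_distrib_right vec_lambda_beta
      by (intro sum.cong refl) simp
    finally show ?thesis by simp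
  qed
  then have \<Gamma>: "christoffel_form c ?x h a = matrix_inv ?G *v K" by (simp add: vec_eq_iff)
  have "gram c ?x (matrix_inv ?G *v K) b = b \<bullet> (?G *v (matrix_inv ?G *v K))"
    using gram_symmetric[OF c, of _ b] by (simp add: gram_def)
  also have "\<dots> = b \<bullet> K"
    by (simp add: matrix_vector_mul_assoc matrix_inv_inverse invertible_metric_matrix[OF c])
  also have "b \<bullet> K = (\<Sum>l\<in>UNIV. \<Sum>i\<in>UNIV. \<Sum>j\<in>UNIV.
      (?m i j l * h $ i * a $ j * b $ l + ?m j i l * h $ i * a $ j * b $ l
       - ?m l i j * b $ l * h $ i * a $ j) / 2)"
    by (simp add: K_def inner_vec_def sum_distrib_left algebra_simps diff_divide_distrib add_divide_distrib)
  also have "\<dots> = ((\<Sum>l\<in>UNIV. \<Sum>i\<in>UNIV. \<Sum>j\<in>UNIV. ?m i j l * h $ i * a $ j * b $ l)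
      + (\<Sum>l\<in>UNIV. \<Sum>i\<in>UNIV. \<Sum>j\<in>UNIV. ?m j i l * h $ i * a $ j * b $ l)
      - (\<Sum>l\<in>UNIV. \<Sum>i\<in>UNIV. \<Sum>j\<in>UNIV. ?m l i j * b $ l * h $ i * a $ j)) / 2"
    by (simp add: sum.distrib sum_subtractf sum_divide_distrib add_divide_distrib diff_divide_distrib)
  also have "(\<Sum>l\<in>UNIV. \<Sum>i\<in>UNIV. \<Sum>j\<in>UNIV. ?m i j l * h $ i * a $ j * b $ l)
      = gram_deriv c ?x h a b"
    unfolding gram_deriv_expand[OF c] by (subst sum.swap, subst (2) sum.swap) (rule refl)
  also have "(\<Sum>l\<in>UNIV. \<Sum>i\<in>UNIV. \<Sum>j\<in>UNIV. ?m j i l * h $ i * a $ j * b $ l)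
      = (\<Sum>i\<in>UNIV. \<Sum>j\<in>UNIV. \<Sum>l\<in>UNIV. ?m j i l * h $ i * a $ j * b $ l)"
    by (subst sum.swap, subst (2) sum.swap) (rule refl)
  also have "\<dots> = gram_deriv c ?x a h b"
    unfolding gram_deriv_expand[OF c] by (subst sum.swap) (simp add: mult_ac)
  also have "(\<Sum>l\<in>UNIV. \<Sum>i\<in>UNIV. \<Sum>j\<in>UNIV. ?m l i j * b $ l * h $ i * a $ j)
      = gram_deriv c ?x b h a"
    unfolding gram_deriv_expand[OF c] ..
  finally show ?thesis unfolding \<Gamma> .
qed

text \<open>Differentiates \<open>gram_change\<close> in direction \<open>h\<close>. Although
  \<open>a\<close> and \<open>b\<close> are constant in \<open>c\<close>, their images under the
  Jacobian vary, which produces the two second derivative terms.\<close>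

lemma gram_deriv_change:
  assumes cd: "c \<in> charts_at A p" "d \<in> charts_at A p"
  defines "J \<equiv> jac c d (coord c p)" and "H \<equiv> hess c d (coord c p)"
  shows "gram_deriv c (coord c p) h a b
    = gram_deriv d (coord d p) (J h) (J a) (J b)
      + gram d (coord d p) (H a h) (J b) + gram d (coord d p) (H b h) (J a)"
proof -
  have A: "c \<in> A" "d \<in> A" "p \<in> cdom c" "p \<in> cdom d" using cd by (auto simp: charts_at_def)
  let ?x = "coord c p"
  have D: "((\<lambda>y. gram c y a b) has_derivative (\<lambda>h. gram_deriv c ?x h a b)) (at ?x)"
    using has_derivative_quadratic_form[OF metric_matrix_has_derivative[OF cd(1)]
        has_derivative_const[of a] has_derivative_const[of b]]
    by (simp add: gram_def[abs_def] gram_deriv_def)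
  have "((\<lambda>y. metric_matrix A g d (transition c d y)) has_derivative
      (\<lambda>h. metric_deriv d (coord d p) (J h))) (at ?x)"
    unfolding J_def
    by (rule has_derivative_compose[OF transition_has_derivative[OF cd]])
      (simp add: transition_coord A metric_matrix_has_derivative[OF cd(2)])
  from has_derivative_quadratic_form[OF this jac_has_derivative[OF cd, of a] jac_has_derivative[OF cd, of b]]
  have "((\<lambda>y. gram d (transition c d y) (jac c d y a) (jac c d y b)) has_derivative
      (\<lambda>h. gram d (coord d p) (H a h) (J b) + gram_deriv d (coord d p) (J h) (J a) (J b)
          + gram d (coord d p) (J a) (H b h))) (at ?x)"
    by (simp add: gram_def gram_deriv_def transition_coord A J_def H_def)
  then have "((\<lambda>y. gram c y a b) has_derivative
      (\<lambda>h. gram d (coord d p) (H a h) (J b) + gram_deriv d (coord d p) (J h) (J a) (J b)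
          + gram d (coord d p) (J a) (H b h))) (at ?x)"
    by (rule has_derivative_transform_within_open[OF _ open_overlap[OF A(1,2)]])
      (use A in \<open>auto simp: transition_coord charts_at_def gram_change[symmetric]\<close>)
  from fun_cong[OF has_derivative_unique[OF D this], of h] show ?thesis
    using gram_symmetric[OF cd(2), of "J a"] by simp
qed

text \<open>By the Koszul formula: of the six second derivative terms, only those with
  \<open>hess c d (coord c p) a h\<close> paired with \<open>b\<close> survive, because second derivatives are symmetric.\<close>

lemma christoffel_form_change:
  assumes cd: "c \<in> charts_at A p" "d \<in> charts_at A p"
  defines "J \<equiv> jac c d (coord c p)"
  shows "J (christoffel_form c (coord c p) h a)
    = christoffel_form d (coord d p) (J h) (J a) + hess c d (coord c p) a h"
proof (rule gram_nondegenerate[OF cd(2)])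
  fix b
  let ?H = "hess c d (coord c p)"
  \<comment> \<open>Jacobians are invertible by the cocycle rule, so the test vector
    \<open>b\<close> comes from a vector of the chart \<open>c\<close>.\<close>
  define b' where "b' = jac d c (coord d p) b"
  have b: "b = J b'" unfolding J_def b'_def by (simp add: jac_cocycle cd jac_refl)
  have "gram d (coord d p) (J (christoffel_form c (coord c p) h a)) b
      = gram c (coord c p) (christoffel_form c (coord c p) h a) b'"
    unfolding b J_def by (rule gram_change[OF cd, symmetric])
  also have "\<dots> = (gram_deriv d (coord d p) (J h) (J a) (J b')
      + gram_deriv d (coord d p) (J a) (J h) (J b') - gram_deriv d (coord d p) (J b') (J h) (J a)) / 2
      + gram d (coord d p) (?H a h) (J b')"
    unfolding gram_christoffel_form[OF cd(1)] gram_deriv_change[OF cd] J_def[symmetric]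
    using hess_symmetric[OF cd, of a h] hess_symmetric[OF cd, of b'] by (simp add: field_simps)
  also have "\<dots> = gram d (coord d p) (christoffel_form d (coord d p) (J h) (J a) + ?H a h) b"
    unfolding linear_add[OF linear_gram_left] gram_christoffel_form[OF cd(2)] b ..
  finally show "gram d (coord d p) (J (christoffel_form c (coord c p) h a)) b
      = gram d (coord d p) (christoffel_form d (coord d p) (J h) (J a) + ?H a h) b" .
qed

lemma continuous_on_christoffel:
  assumes "c \<in> A"
  shows "continuous_on (coord c ` cdom c) (\<lambda>x. christoffel A g c x k i j)"
proof -
  have charts: "\<exists>p. x = coord c p \<and> c \<in> charts_at A p" if "x \<in> coord c ` cdom c" for x
    using that assms by (auto simp: charts_at_def)
  have mp: "continuous_on (coord c ` cdom c) (\<lambda>x. metric_partial A g c x k i j)" for k i j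
  proof -
    have "continuous_on (coord c ` cdom c) (\<lambda>x. metric_deriv c x (axis k 1) $ i $ j)"
      using C_on_metric_matrix[OF assms, of "Suc 0"]
      by (auto simp: metric_deriv_def intro!: continuous_intros)
    then show ?thesis
      by (rule continuous_on_eq) (metis charts metric_partial_eq)
  qed
  have "continuous_on (coord c ` cdom c) (metric_matrix A g c)"
    using C_on_metric_matrix[OF assms, of 0] by simp
  then have "continuous_on (coord c ` cdom c) (\<lambda>x. metric_matrix A g c x $ i $ j)" for i j
    by (intro continuous_intros)
  then have inv: "continuous_on (coord c ` cdom c) (\<lambda>x. matrix_inv (metric_matrix A g c x) $ k $ l)" for k l
    by (rule continuous_on_matrix_inv) (metis charts invertible_metric_matrix)
  show ?thesis
    unfolding christoffel_def
    by (intro continuous_on_divide continuous_on_sum continuous_on_mult continuous_on_add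
        continuous_on_diff continuous_on_const mp inv) auto
qed

end

section \<open>Covariant derivatives and parallel fields along a trajectory\<close>

text \<open>The right end \<open>T\<close> is separate from the time \<open>t\<close> of the claim,
  because u is differentiated in its end time and must be considered on a whole interval of end
  times.\<close>

locale riemannian_trajectory = riemannian M A g
  for M :: "'a topology" and A :: "('a, 'n::finite) chart set" and g :: "('a, 'n) metric" +
  fixes \<gamma> :: "real \<Rightarrow> 'a" and r T :: real
  assumes rT: "r < T" and traj: "smooth_trajectory M A {r..T} \<gamma>"
begin

lemma openin_chart_times:
  assumes "c \<in> A"
  shows "openin (top_of_set {r..T}) {s \<in> {r..T}. \<gamma> s \<in> cdom c}"
  using traj openin_continuous_map_preimage[OF _ openin_cdom[OF assms], of "top_of_set {r..T}" \<gamma>]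
  by (simp add: smooth_trajectory_def)

lemma chart_exists: "s \<in> {r..T} \<Longrightarrow> \<exists>c. c \<in> charts_at A (\<gamma> s)"
  using traj by (intro chart_covers) (auto simp: smooth_trajectory_def continuous_map_def)

lemma chart_near:
  assumes "s \<in> {r..T}" "c \<in> charts_at A (\<gamma> s)"
  obtains e where "e > 0" "\<And>\<tau>. \<tau> \<in> {r..T} \<Longrightarrow> dist \<tau> s < e \<Longrightarrow> c \<in> charts_at A (\<gamma> \<tau>)"
proof -
  have "c \<in> A" "s \<in> {s \<in> {r..T}. \<gamma> s \<in> cdom c}" using assms by (auto simp: charts_at_def)
  then obtain e where "e > 0" "\<And>\<tau>. \<tau> \<in> {r..T} \<Longrightarrow> dist \<tau> s < e \<Longrightarrow> \<gamma> \<tau> \<in> cdom c"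
    using openin_chart_times[of c] unfolding openin_euclidean_subtopology_iff by blast
  then show thesis using that \<open>c \<in> A\<close> by (auto simp: charts_at_def)
qed

definition vel :: "('a, 'n) chart \<Rightarrow> real \<Rightarrow> real^'n" where
  "vel c s = vector_derivative (\<lambda>s. coord c (\<gamma> s)) (at s within {r..T})"

lemma
  assumes "c \<in> A"
  shows coord_has_derivative: "s \<in> {r..T} \<Longrightarrow> \<gamma> s \<in> cdom c \<Longrightarrow>
      ((\<lambda>s. coord c (\<gamma> s)) has_vector_derivative vel c s) (at s within {r..T})"
    and continuous_on_vel: "continuous_on {s \<in> {r..T}. \<gamma> s \<in> cdom c} (vel c)"
  using smooth_on_interval_derivative[OF rT openin_chart_times[OF assms], of "\<lambda>s. coord c (\<gamma> s)"]
    traj assms by (auto simp: smooth_trajectory_def vel_def[abs_def])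

text \<open>\<open>velocity\<close> takes its derivative within the given interval. On a
  nondegenerate subinterval this is the derivative within \<open>{r..T}\<close>; for
  \<open>a = b\<close> derivatives would not be unique.\<close>

lemma connection_term_eq:
  assumes "r \<le> a" "a < b" "b \<le> T" "s \<in> {a..b}" "c \<in> charts_at A (\<gamma> s)"
  shows "connection_term A g {a..b} \<gamma> s X c = christoffel_form c (coord c (\<gamma> s)) (vel c s) (X c)"
proof -
  have "((\<lambda>s. coord c (\<gamma> s)) has_vector_derivative vel c s) (at s within {a..b})"
    using assms by (intro has_vector_derivative_within_subset[OF coord_has_derivative])
      (auto simp: charts_at_def)
  then have "vector_derivative (\<lambda>s. coord c (\<gamma> s)) (at s within {a..b}) = vel c s"
    using assms by (intro vector_derivative_within at_within_interval_neq_bot) auto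
  then show ?thesis
    using assms by (simp add: connection_term_def christoffel_form_def velocity_def)
qed

section \<open>Change of chart along the trajectory\<close>

lemma vel_change:
  assumes s: "s \<in> {r..T}" and cd: "c \<in> charts_at A (\<gamma> s)" "d \<in> charts_at A (\<gamma> s)"
  shows "vel d s = jac c d (coord c (\<gamma> s)) (vel c s)"
proof -
  have A: "c \<in> A" "d \<in> A" "\<gamma> s \<in> cdom c" "\<gamma> s \<in> cdom d" using cd by (auto simp: charts_at_def)
  obtain e where e: "e > 0" "\<And>\<tau>. \<tau> \<in> {r..T} \<Longrightarrow> dist \<tau> s < e \<Longrightarrow> c \<in> charts_at A (\<gamma> \<tau>)"
    using chart_near[OF s cd(1)] by blast
  have "((\<lambda>s. coord c (\<gamma> s)) has_derivative (\<lambda>t. t *\<^sub>R vel c s)) (at s within {r..T})"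
    using coord_has_derivative[OF A(1) s A(3)] by (simp add: has_vector_derivative_def)
  from has_derivative_compose[OF this transition_has_derivative[OF cd]]
  have "((\<lambda>s. transition c d (coord c (\<gamma> s))) has_vector_derivative
      jac c d (coord c (\<gamma> s)) (vel c s)) (at s within {r..T})"
    by (simp add: has_vector_derivative_def linear_scale[OF linear_jac[OF cd]])
  then have "((\<lambda>s. coord d (\<gamma> s)) has_vector_derivative
      jac c d (coord c (\<gamma> s)) (vel c s)) (at s within {r..T})"
    by (rule has_vector_derivative_transform_within[OF _ e(1) s])
      (use e(2) in \<open>auto simp: charts_at_def transition_coord\<close>)
  with coord_has_derivative[OF A(2) s A(4)] show ?thesis
    by (rule vector_derivative_unique_within[OF at_within_interval_neq_bot[OF rT s]])
qed

text \<open>The product rule for the relation \<open>X d = J (X c)\<close> with the time-dependent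
  Jacobian \<open>J\<close>. The derivative of \<open>J\<close> gives a second derivative term, the
  very one by which the Christoffel symbols fail to be tensorial. Leaving \<open>D\<close> free
  covers general covariant derivatives and, with \<open>D = 0\<close>, parallel fields.\<close>

lemma derivative_change:
  assumes S: "S \<subseteq> {r..T}" "s \<in> S" and cd: "c \<in> charts_at A (\<gamma> s)" "d \<in> charts_at A (\<gamma> s)"
    and X: "vector_field_along A S \<gamma> X"
    and D: "((\<lambda>\<tau>. X \<tau> c) has_vector_derivative
        D - christoffel_form c (coord c (\<gamma> s)) (vel c s) (X s c)) (at s within S)"
  shows "((\<lambda>\<tau>. X \<tau> d) has_vector_derivative
      jac c d (coord c (\<gamma> s)) D - christoffel_form d (coord d (\<gamma> s)) (vel d s) (X s d)) (at s within S)"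
proof -
  have A: "c \<in> A" "d \<in> A" "\<gamma> s \<in> cdom c" "\<gamma> s \<in> cdom d" using cd by (auto simp: charts_at_def)
  have s: "s \<in> {r..T}" using S by auto
  define X' where "X' = D - christoffel_form c (coord c (\<gamma> s)) (vel c s) (X s c)"
  let ?J = "\<lambda>\<tau>. jac c d (coord c (\<gamma> \<tau>))" and ?H = "hess c d (coord c (\<gamma> s))"
  have Xs: "X s d = ?J s (X s c)"
    using X S by (auto simp: vector_field_along_def intro!: tangent_space_change cd)
  have "((\<lambda>s. coord c (\<gamma> s)) has_derivative (\<lambda>t. t *\<^sub>R vel c s)) (at s within S)"
    using has_vector_derivative_within_subset[OF coord_has_derivative[OF A(1) s A(3)] S(1)]
    by (simp add: has_vector_derivative_def)
  from has_derivative_compose[OF this jac_has_derivative[OF cd]]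
  have J: "((\<lambda>\<tau>. ?J \<tau> h) has_vector_derivative ?H h (vel c s)) (at s within S)" for h
    by (simp add: has_vector_derivative_def linear_scale[OF linear_hess[OF cd]])
  have "((\<lambda>\<tau>. X \<tau> c $ j) has_real_derivative X' $ j) (at s within S)" for j
    using bounded_linear.has_vector_derivative[OF bounded_linear_vec_nth D]
    by (simp add: has_real_derivative_iff_has_vector_derivative X'_def)
  \<comment> \<open>Expansion in the standard basis requires the derivative of the Jacobian on fixed
    vectors alone.\<close>
  then have "((\<lambda>\<tau>. \<Sum>j\<in>UNIV. X \<tau> c $ j *\<^sub>R ?J \<tau> (axis j 1)) has_vector_derivative
      (\<Sum>j\<in>UNIV. X s c $ j *\<^sub>R ?H (axis j 1) (vel c s) + X' $ j *\<^sub>R ?J s (axis j 1))) (at s within S)"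
    by (intro has_vector_derivative_sum has_vector_derivative_scaleR J) auto
  \<comment> \<open>\<open>linear_hess\<close> gives linearity in the last argument; symmetry moves
    the basis vector to that place.\<close>
  moreover have "(\<Sum>j\<in>UNIV. X s c $ j *\<^sub>R ?H (axis j 1) (vel c s) + X' $ j *\<^sub>R ?J s (axis j 1))
      = ?H (vel c s) (\<Sum>j\<in>UNIV. X s c $ j *\<^sub>R axis j 1) + ?J s (\<Sum>j\<in>UNIV. X' $ j *\<^sub>R axis j 1)"
    by (simp add: sum.distrib linear_sum[OF linear_hess[OF cd]] linear_scale[OF linear_hess[OF cd]]
        linear_sum[OF linear_jac[OF cd]] linear_scale[OF linear_jac[OF cd]]
        hess_symmetric[OF cd, of _ "vel c s"] cong: sum.cong)
  moreover have "\<dots> = ?J s D - christoffel_form d (coord d (\<gamma> s)) (vel d s) (X s d)"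
    unfolding basis_expansion_axis X'_def linear_diff[OF linear_jac[OF cd]]
      christoffel_form_change[OF cd] vel_change[OF s cd] Xs
    by (simp add: hess_symmetric[OF cd, of "X s c"])
  ultimately have der: "((\<lambda>\<tau>. \<Sum>j\<in>UNIV. X \<tau> c $ j *\<^sub>R ?J \<tau> (axis j 1)) has_vector_derivative
      ?J s D - christoffel_form d (coord d (\<gamma> s)) (vel d s) (X s d)) (at s within S)" by simp
  obtain e where e: "e > 0" "\<And>\<tau>. \<tau> \<in> {r..T} \<Longrightarrow> dist \<tau> s < e \<Longrightarrow> c \<in> charts_at A (\<gamma> \<tau>)"
    using chart_near[OF s cd(1)] by blast
  obtain e' where e': "e' > 0" "\<And>\<tau>. \<tau> \<in> {r..T} \<Longrightarrow> dist \<tau> s < e' \<Longrightarrow> d \<in> charts_at A (\<gamma> \<tau>)"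
    using chart_near[OF s cd(2)] by blast
  show ?thesis
  proof (rule has_vector_derivative_transform_within[OF der _ S(2)])
    show "0 < min e e'" using e e' by simp
    fix \<tau> assume \<tau>: "\<tau> \<in> S" "dist \<tau> s < min e e'"
    then have cd': "c \<in> charts_at A (\<gamma> \<tau>)" "d \<in> charts_at A (\<gamma> \<tau>)" using e e' S by auto
    have "X \<tau> d = ?J \<tau> (\<Sum>j\<in>UNIV. X \<tau> c $ j *\<^sub>R axis j 1)"
      unfolding basis_expansion_axis
      using X \<tau> by (auto simp: vector_field_along_def intro!: tangent_space_change cd')
    then show "(\<Sum>j\<in>UNIV. X \<tau> c $ j *\<^sub>R ?J \<tau> (axis j 1)) = X \<tau> d"
      by (simp only: linear_sum[OF linear_jac[OF cd']] linear_scale[OF linear_jac[OF cd']])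
  qed
qed

text \<open>A single chart at \<open>s\<close> suffices; \<open>derivative_change\<close> supplies
  the others.\<close>

lemma has_covariant_derivativeI:
  assumes "r \<le> a" "a < b" "b \<le> T" "s \<in> {a..b}" "c \<in> charts_at A (\<gamma> s)"
    and "vector_field_along A {a..b} \<gamma> X" "D \<in> tangent_space A (\<gamma> s)"
    and "((\<lambda>\<tau>. X \<tau> c) has_vector_derivative
        D c - christoffel_form c (coord c (\<gamma> s)) (vel c s) (X s c)) (at s within {a..b})"
  shows "has_covariant_derivative A g {a..b} \<gamma> X D s"
  unfolding has_covariant_derivative_def
proof (intro conjI ballI)
  fix d assume d: "d \<in> charts_at A (\<gamma> s)"
  show "((\<lambda>\<tau>. X \<tau> d) has_vector_derivative D d - connection_term A g {a..b} \<gamma> s (X s) d)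
      (at s within {a..b})"
    unfolding connection_term_eq[OF assms(1-4) d] tangent_space_change[OF assms(7,5) d]
    using assms d by (intro derivative_change) auto
qed fact

lemma has_covariant_derivative_unique:
  assumes "has_covariant_derivative A g {r..T} \<gamma> X D s" "has_covariant_derivative A g {r..T} \<gamma> X D' s"
    and s: "s \<in> {r..T}"
  shows "D = D'"
proof -
  obtain c where c: "c \<in> charts_at A (\<gamma> s)" using chart_exists[OF s] by blast
  have "D c - connection_term A g {r..T} \<gamma> s (X s) c = D' c - connection_term A g {r..T} \<gamma> s (X s) c"
    using assms c unfolding has_covariant_derivative_def
    by (intro vector_derivative_unique_within[OF at_within_interval_neq_bot[OF rT s]]) auto
  then show ?thesis
    using assms c unfolding has_covariant_derivative_def
    by (intro tangent_space_eqI[of D "\<gamma> s" D' c]) auto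
qed

section \<open>Parallel fields: linearity, constant length, uniqueness\<close>

abbreviation parallel :: "real \<Rightarrow> real \<Rightarrow> (real \<Rightarrow> ('a, 'n) tangent) \<Rightarrow> bool" where
  "parallel a b X \<equiv> parallel_along A g {a..b} \<gamma> X"

text \<open>On a degenerate interval the derivative condition is void, on either side.\<close>

lemma parallel_iff:
  assumes "r \<le> a" "a \<le> b" "b \<le> T"
  shows "parallel a b X \<longleftrightarrow> vector_field_along A {a..b} \<gamma> X \<and>
    (\<forall>s\<in>{a..b}. \<forall>c\<in>charts_at A (\<gamma> s). ((\<lambda>\<tau>. X \<tau> c) has_vector_derivative
       - christoffel_form c (coord c (\<gamma> s)) (vel c s) (X s c)) (at s within {a..b}))"
proof (cases "a = b")
  case True
  then show ?thesis
    by (auto simp: parallel_along_def has_covariant_derivative_def tangent_space_zero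
        has_vector_derivative_def has_derivative_within_singleton_iff
        bounded_linear_minus[OF bounded_linear_scaleR_left])
next
  case False
  then show ?thesis
    using assms unfolding parallel_along_def has_covariant_derivative_def
    by (auto simp: connection_term_eq tangent_space_zero)
qed

text \<open>The equation is checked in one chart for each time, and this chart may depend on the
  time.\<close>

lemma parallelI:
  assumes "r \<le> a" "a \<le> b" "b \<le> T" "vector_field_along A {a..b} \<gamma> X"
    and "\<And>s. s \<in> {a..b} \<Longrightarrow> \<exists>c\<in>charts_at A (\<gamma> s). ((\<lambda>\<tau>. X \<tau> c) has_vector_derivative
       - christoffel_form c (coord c (\<gamma> s)) (vel c s) (X s c)) (at s within {a..b})"
  shows "parallel a b X"
  unfolding parallel_iff[OF assms(1-3)]
proof (intro conjI ballI)
  fix s d assume s: "s \<in> {a..b}" and d: "d \<in> charts_at A (\<gamma> s)"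
  obtain c where c: "c \<in> charts_at A (\<gamma> s)" "((\<lambda>\<tau>. X \<tau> c) has_vector_derivative
       0 - christoffel_form c (coord c (\<gamma> s)) (vel c s) (X s c)) (at s within {a..b})"
    using assms(5)[OF s] by auto
  have "((\<lambda>\<tau>. X \<tau> d) has_vector_derivative jac c d (coord c (\<gamma> s)) 0
       - christoffel_form d (coord d (\<gamma> s)) (vel d s) (X s d)) (at s within {a..b})"
    using assms s by (intro derivative_change c d) auto
  then show "((\<lambda>\<tau>. X \<tau> d) has_vector_derivative
       - christoffel_form d (coord d (\<gamma> s)) (vel d s) (X s d)) (at s within {a..b})"
    by (simp add: linear_0[OF linear_jac[OF c(1) d]])
qed fact

text \<open>The velocity in the definition depends on the interval; in \<open>parallel_iff\<close>
  it is replaced by \<open>vel\<close>, which does not.\<close>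

lemma parallel_subinterval:
  assumes "parallel a b X" "r \<le> a" "a \<le> a'" "a' \<le> b'" "b' \<le> b" "b \<le> T"
  shows "parallel a' b' X"
proof -
  have sub: "{a'..b'} \<subseteq> {a..b}" using assms by auto
  have "parallel a b X \<longleftrightarrow> vector_field_along A {a..b} \<gamma> X \<and>
    (\<forall>s\<in>{a..b}. \<forall>c\<in>charts_at A (\<gamma> s). ((\<lambda>\<tau>. X \<tau> c) has_vector_derivative
       - christoffel_form c (coord c (\<gamma> s)) (vel c s) (X s c)) (at s within {a..b}))"
    using assms by (intro parallel_iff) auto
  moreover have "parallel a' b' X \<longleftrightarrow> vector_field_along A {a'..b'} \<gamma> X \<and>
    (\<forall>s\<in>{a'..b'}. \<forall>c\<in>charts_at A (\<gamma> s). ((\<lambda>\<tau>. X \<tau> c) has_vector_derivative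
       - christoffel_form c (coord c (\<gamma> s)) (vel c s) (X s c)) (at s within {a'..b'}))"
    using assms by (intro parallel_iff) auto
  ultimately show ?thesis
    using assms(1) sub
    by (meson has_vector_derivative_within_subset subsetD vector_field_along_def)
qed

lemma vector_field_sum:
  assumes "\<And>i. i \<in> I \<Longrightarrow> vector_field_along A S \<gamma> (X i)"
  shows "vector_field_along A S \<gamma> (\<lambda>s c. \<Sum>i\<in>I. a s i *\<^sub>R X i s c)"
  using assms by (auto simp: vector_field_along_def intro!: tangent_space_sum)

lemma christoffel_form_sum:
  "christoffel_form c x h (\<Sum>i\<in>I. a i *\<^sub>R y i) = (\<Sum>i\<in>I. a i *\<^sub>R christoffel_form c x h (y i))"
  by (simp add: linear_sum[OF linear_christoffel_form] linear_scale[OF linear_christoffel_form])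

lemma parallel_sum:
  assumes ab: "r \<le> a" "a \<le> b" "b \<le> T" and X: "\<And>i. i \<in> I \<Longrightarrow> parallel a b (X i)"
  shows "parallel a b (\<lambda>s c. \<Sum>i\<in>I. k i *\<^sub>R X i s c)"
  unfolding parallel_iff[OF ab]
proof (intro conjI ballI)
  show "vector_field_along A {a..b} \<gamma> (\<lambda>s c. \<Sum>i\<in>I. k i *\<^sub>R X i s c)"
    using X by (intro vector_field_sum) (auto simp: parallel_iff[OF ab])
next
  fix s c assume "s \<in> {a..b}" "c \<in> charts_at A (\<gamma> s)"
  then show "((\<lambda>\<tau>. \<Sum>i\<in>I. k i *\<^sub>R X i \<tau> c) has_vector_derivative
       - christoffel_form c (coord c (\<gamma> s)) (vel c s) (\<Sum>i\<in>I. k i *\<^sub>R X i s c)) (at s within {a..b})"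
    using X unfolding parallel_iff[OF ab] christoffel_form_sum sum_negf[symmetric] scaleR_minus_right[symmetric]
    by (intro has_vector_derivative_sum bounded_linear.has_vector_derivative[OF bounded_linear_scaleR_right])
      auto
qed

text \<open>Metric compatibility of the connection: the change of the metric along the trajectory
  cancels the two terms from differentiating \<open>X\<close>, so the derivative is 0 at every
  time.\<close>

lemma parallel_norm_constant:
  assumes ab: "r \<le> a" "a \<le> b" "b \<le> T" and X: "parallel a b X" and s: "s \<in> {a..b}"
  shows "g (\<gamma> s) (X s) (X s) = g (\<gamma> a) (X a) (X a)"
proof -
  have vf: "X \<tau> \<in> tangent_space A (\<gamma> \<tau>)" if "\<tau> \<in> {a..b}" for \<tau>
    using X that by (simp add: parallel_iff[OF ab] vector_field_along_def)
  have "\<exists>k. \<forall>\<tau>\<in>{a..b}. g (\<gamma> \<tau>) (X \<tau>) (X \<tau>) = k"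
  proof (rule has_derivative_zero_constant)
    fix \<tau> assume \<tau>: "\<tau> \<in> {a..b}"
    then have \<tau>': "\<tau> \<in> {r..T}" using ab by auto
    obtain c where c: "c \<in> charts_at A (\<gamma> \<tau>)" using chart_exists[OF \<tau>'] by blast
    have A: "c \<in> A" "\<gamma> \<tau> \<in> cdom c" using c by (auto simp: charts_at_def)
    obtain e where e: "e > 0" "\<And>\<sigma>. \<sigma> \<in> {r..T} \<Longrightarrow> dist \<sigma> \<tau> < e \<Longrightarrow> c \<in> charts_at A (\<gamma> \<sigma>)"
      using chart_near[OF \<tau>' c] by blast
    let ?x = "coord c (\<gamma> \<tau>)" and ?v = "vel c \<tau>" and ?y = "X \<tau> c"
    let ?G = "\<lambda>\<sigma>. metric_matrix A g c (coord c (\<gamma> \<sigma>))"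
    have "((\<lambda>s. coord c (\<gamma> s)) has_derivative (\<lambda>t. t *\<^sub>R ?v)) (at \<tau> within {a..b})"
      using has_vector_derivative_within_subset[OF coord_has_derivative[OF A(1) \<tau>' A(2)], of "{a..b}"] ab
      by (simp add: has_vector_derivative_def)
    from has_derivative_compose[OF this metric_matrix_has_derivative[OF c]]
    have G: "(?G has_derivative (\<lambda>t. metric_deriv c ?x (t *\<^sub>R ?v))) (at \<tau> within {a..b})" .
    have Y: "((\<lambda>\<sigma>. X \<sigma> c) has_derivative (\<lambda>t. t *\<^sub>R - christoffel_form c ?x ?v ?y)) (at \<tau> within {a..b})"
      using X \<tau> c by (simp add: parallel_iff[OF ab] has_vector_derivative_def)
    have lin: "linear (metric_deriv c ?x)"
      by (rule has_derivative_linear[OF metric_matrix_has_derivative[OF c]])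
    \<comment> \<open>When two arguments of the Koszul formula agree, its last two terms
      cancel.\<close>
    have "gram c ?x (christoffel_form c ?x ?v ?y) ?y = gram_deriv c ?x ?v ?y ?y / 2"
      by (simp add: gram_christoffel_form[OF c])
    moreover have "gram c ?x ?y (christoffel_form c ?x ?v ?y) = gram c ?x (christoffel_form c ?x ?v ?y) ?y"
      by (rule gram_symmetric[OF c])
    ultimately have zero: "(t *\<^sub>R - christoffel_form c ?x ?v ?y) \<bullet> (?G \<tau> *v ?y)
        + ?y \<bullet> (metric_deriv c ?x (t *\<^sub>R ?v) *v ?y) + ?y \<bullet> (?G \<tau> *v (t *\<^sub>R - christoffel_form c ?x ?v ?y)) = 0" for t
      unfolding scaleR_minus_right scaleR_minus_left[symmetric]
      by (simp add: gram_def gram_deriv_def linear_scale[OF lin] scaleR_matrix_vector_assoc[symmetric]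
          matrix_vector_mult_scaleR del: scaleR_minus_left)
    have "((\<lambda>\<sigma>. X \<sigma> c \<bullet> (?G \<sigma> *v X \<sigma> c)) has_derivative (\<lambda>t. 0)) (at \<tau> within {a..b})"
      using has_derivative_quadratic_form[OF G Y Y] unfolding zero .
    then show "((\<lambda>\<tau>. g (\<gamma> \<tau>) (X \<tau>) (X \<tau>)) has_derivative (\<lambda>t. 0)) (at \<tau> within {a..b})"
    proof (rule has_derivative_transform_within[OF _ e(1) \<tau>])
      fix \<sigma> assume "\<sigma> \<in> {a..b}" "dist \<sigma> \<tau> < e"
      then show "X \<sigma> c \<bullet> (?G \<sigma> *v X \<sigma> c) = g (\<gamma> \<sigma>) (X \<sigma>) (X \<sigma>)"
        using metric_eq_gram[of c "\<gamma> \<sigma>" "X \<sigma>" "X \<sigma>"] e(2)[of \<sigma>] vf ab by (auto simp: gram_def)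
    qed
  qed simp
  then show ?thesis using s ab by (metis atLeastAtMost_iff order_refl)
qed

text \<open>Constant length and positivity. It works in both time directions: the frame construction
  goes back from \<open>s\<close> to \<open>r\<close>.\<close>

lemma parallel_zero:
  assumes ab: "r \<le> a" "a \<le> b" "b \<le> T" and X: "parallel a b X"
    and s: "s \<in> {a..b}" "s' \<in> {a..b}" and 0: "X s = (\<lambda>c. 0)"
  shows "X s' = (\<lambda>c. 0)"
proof (rule ccontr)
  assume *: "X s' \<noteq> (\<lambda>c. 0)"
  have vf: "X \<tau> \<in> tangent_space A (\<gamma> \<tau>)" if "\<tau> \<in> {a..b}" for \<tau>
    using X that by (simp add: parallel_iff[OF ab] vector_field_along_def)
  have p: "\<gamma> \<tau> \<in> topspace M" if "\<tau> \<in> {a..b}" for \<tau>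
    using that ab traj by (auto simp: smooth_trajectory_def continuous_map_def)
  have "0 < g (\<gamma> s') (X s') (X s')" by (rule metric_pos[OF p[OF s(2)] vf[OF s(2)] vf[OF s(2)] *])
  also have "\<dots> = g (\<gamma> s) (X s) (X s)"
    using parallel_norm_constant[OF ab X] s by metis
  also have "\<dots> = 0"
    using metric_sum[OF _ p[OF s(1)] _ tangent_space_zero, of "{}"] by (simp add: 0)
  finally show False by simp
qed

lemma parallel_unique:
  assumes ab: "r \<le> a" "a \<le> b" "b \<le> T" and X: "parallel a b X" and Y: "parallel a b Y"
    and eq: "X a = Y a" and s: "s \<in> {a..b}"
  shows "X s = Y s"
proof -
  \<comment> \<open>The difference of \<open>X\<close> and \<open>Y\<close>, written as a sum over
    the booleans so that \<open>parallel_sum\<close> applies.\<close>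
  let ?Z = "\<lambda>s c. \<Sum>i\<in>UNIV. (if i then 1 else -1) *\<^sub>R (if i then X else Y) s c"
  have "parallel a b ?Z" using ab by (rule parallel_sum) (use X Y in auto)
  then have "?Z s = (\<lambda>c. 0)"
    by (rule parallel_zero[OF ab _ _ s, where s = a]) (use ab eq in \<open>auto simp: UNIV_bool\<close>)
  then show ?thesis by (auto simp: UNIV_bool fun_eq_iff)
qed

section \<open>Existence of parallel fields and parallel transport\<close>

lemma parallel_exists_in_chart:
  assumes ab: "r \<le> a" "a \<le> b" "b \<le> T" and c: "c \<in> A" "\<And>s. s \<in> {a..b} \<Longrightarrow> \<gamma> s \<in> cdom c"
    and w: "w \<in> tangent_space A (\<gamma> a)"
  shows "\<exists>X. parallel a b X \<and> X a = w"
proof -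
  have c': "c \<in> charts_at A (\<gamma> s)" if "s \<in> {a..b}" for s using c that by (auto simp: charts_at_def)
  let ?\<Gamma> = "\<lambda>s y. - christoffel_form c (coord c (\<gamma> s)) (vel c s) y"
  define B where "B s = Blinfun (?\<Gamma> s)" for s
  have "linear (?\<Gamma> s)" for s
    by (intro linear_compose_neg linear_christoffel_form)
  then have B: "blinfun_apply (B s) = ?\<Gamma> s" for s
    unfolding B_def by (intro bounded_linear_Blinfun_apply) (simp add: linear_conv_bounded_linear)
  have sub: "{a..b} \<subseteq> {s \<in> {r..T}. \<gamma> s \<in> cdom c}" using ab c by auto
  have cv: "continuous_on {a..b} (\<lambda>s. vel c s $ i)" for i
    using continuous_on_subset[OF continuous_on_vel[OF c(1)] sub] by (intro continuous_intros)
  have "continuous_on {a..b} (\<lambda>s. coord c (\<gamma> s))"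
    unfolding continuous_on_eq_continuous_within
  proof
    fix s assume s: "s \<in> {a..b}"
    have "s \<in> {r..T}" "{a..b} \<subseteq> {r..T}" using s ab by auto
    from has_vector_derivative_within_subset[OF coord_has_derivative[OF c(1) this(1) c(2)[OF s]] this(2)]
    show "continuous (at s within {a..b}) (\<lambda>s. coord c (\<gamma> s))"
      by (rule has_vector_derivative_continuous)
  qed
  then have cc: "continuous_on {a..b} (\<lambda>s. christoffel A g c (coord c (\<gamma> s)) k i j)" for k i j
    by (rule continuous_on_compose2[OF continuous_on_christoffel[OF c(1)]]) (use c in auto)
  have "continuous_on {a..b} B"
    by (rule continuous_on_blinfun_componentwise)
      (auto simp: B christoffel_form_def intro!: continuous_intros cc cv)
  then obtain Y where Y: "Y a = w c"
    "\<And>s. s \<in> {a..b} \<Longrightarrow> (Y has_vector_derivative B s (Y s)) (at s within {a..b})"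
    using linear_ode_solution[OF ab(2)] by metis
  \<comment> \<open>The solution in the chart \<open>c\<close> is spread to all charts;
    \<open>parallelI\<close> then asks for nothing beyond the equation in \<open>c\<close>.\<close>
  define X where "X s = tangent_of c (\<gamma> s) (Y s)" for s
  have XY: "X s c = Y s" if "s \<in> {a..b}" for s by (simp add: X_def tangent_of_same c'[OF that])
  have "parallel a b X"
  proof (rule parallelI[OF ab])
    show "vector_field_along A {a..b} \<gamma> X"
      by (auto simp: vector_field_along_def X_def intro!: tangent_of_in c')
    fix s assume s: "s \<in> {a..b}"
    have "((\<lambda>\<tau>. X \<tau> c) has_vector_derivative ?\<Gamma> s (X s c)) (at s within {a..b})"
      by (rule has_vector_derivative_transform[OF s, of _ Y])
        (use Y(2)[OF s] XY s in \<open>auto simp: B\<close>)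
    then show "\<exists>c\<in>charts_at A (\<gamma> s). ((\<lambda>\<tau>. X \<tau> c) has_vector_derivative
       - christoffel_form c (coord c (\<gamma> s)) (vel c s) (X s c)) (at s within {a..b})"
      using c'[OF s] by blast
  qed
  moreover have "X a = w"
  proof (rule tangent_space_eqI[OF _ w c'])
    show "X a \<in> tangent_space A (\<gamma> a)" "a \<in> {a..b}"
      using ab by (auto simp: X_def intro!: tangent_of_in c')
    then show "X a c = w c" using XY[of a] Y(1) by simp
  qed
  ultimately show ?thesis by blast
qed

text \<open>At \<open>m\<close> the two one-sided derivatives agree, because the equation determines
  the derivative from the common value.\<close>

lemma parallel_concat:
  assumes ab: "r \<le> a" "a \<le> m" "m \<le> b" "b \<le> T"
    and X: "parallel a m X" and Y: "parallel m b Y" "Y m = X m"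
  shows "parallel a b (\<lambda>s. if s \<in> {a..m} then X s else Y s)" (is "parallel a b ?Z")
proof -
  have am: "r \<le> a" "a \<le> m" "m \<le> T" and mb: "r \<le> m" "m \<le> b" "b \<le> T" and ab': "r \<le> a" "a \<le> b" "b \<le> T"
    using ab by auto
  note X = X[unfolded parallel_iff[OF am]] and Y' = Y(1)[unfolded parallel_iff[OF mb]]
  have un: "{a..b} = {a..m} \<union> {m..b}" using ab by auto
  show ?thesis
    unfolding parallel_iff[OF ab']
  proof (intro conjI ballI)
    show "vector_field_along A {a..b} \<gamma> ?Z"
      using X Y' by (auto simp: vector_field_along_def)
  next
    fix s c assume s: "s \<in> {a..b}" and c: "c \<in> charts_at A (\<gamma> s)"
    let ?\<Gamma> = "\<lambda>X s. - christoffel_form c (coord c (\<gamma> s)) (vel c s) (X s c)"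
    have "((\<lambda>\<tau>. if \<tau> \<in> {a..m} then X \<tau> c else Y \<tau> c) has_vector_derivative
        (if s \<in> {a..m} then ?\<Gamma> X s else ?\<Gamma> Y s)) (at s within {a..b})"
    proof (rule has_vector_derivative_If_within_closures[OF _ un])
      have int: "{a..m} \<inter> {m..b} = {m}" using ab by auto
      show "s \<in> {a..m} \<union> {m..b}" using s un by simp
      have 1: "{a..m} \<union> closure {a..m} \<inter> closure {m..b} = {a..m}" using ab by auto
      have 2: "{m..b} \<union> closure {a..m} \<inter> closure {m..b} = {m..b}" using ab by auto
      show "((\<lambda>\<tau>. X \<tau> c) has_vector_derivative ?\<Gamma> X s)
          (at s within {a..m} \<union> closure {a..m} \<inter> closure {m..b})"
        if "s \<in> {a..m} \<union> closure {a..m} \<inter> closure {m..b}"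
        using that X c unfolding 1 by blast
      show "((\<lambda>\<tau>. Y \<tau> c) has_vector_derivative ?\<Gamma> Y s)
          (at s within {m..b} \<union> closure {a..m} \<inter> closure {m..b})"
        if "s \<in> {m..b} \<union> closure {a..m} \<inter> closure {m..b}"
        using that Y' c unfolding 2 by blast
      show "X s c = Y s c" "?\<Gamma> X s = ?\<Gamma> Y s"
        if "s \<in> closure {a..m}" "s \<in> closure {m..b}"
      proof -
        have "s = m" using that int by auto
        then show "X s c = Y s c" "?\<Gamma> X s = ?\<Gamma> Y s" using Y(2) by simp_all
      qed
    qed
    then show "((\<lambda>\<tau>. ?Z \<tau> c) has_vector_derivative ?\<Gamma> ?Z s) (at s within {a..b})"
      by (simp add: if_distrib[of "\<lambda>X. X c"] if_distrib[of uminus] if_distrib[of "christoffel_form _ _ _"] cong: if_cong)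
  qed
qed

lemma parallel_exists:
  assumes "r \<le> a" "a \<le> b" "b \<le> T" "w \<in> tangent_space A (\<gamma> a)"
  shows "\<exists>X. parallel a b X \<and> X a = w"
proof -
  \<comment> \<open>Bisection: the property passes to adjoining intervals and holds on short ones
    around each point. All \<open>w\<close> are quantified since the second piece starts at the
    value reached by the first. The bounds are premises because \<open>Bolzano\<close> ranges over
    all real centres; outside \<open>{r..T}\<close> they make the claim void.\<close>
  have "r \<le> a \<longrightarrow> b \<le> T \<longrightarrow> (\<forall>w\<in>tangent_space A (\<gamma> a). \<exists>X. parallel a b X \<and> X a = w)"
    using assms(2)
  proof (induction rule: Bolzano)
    case (trans a m b)
    show ?case
    proof (intro impI ballI)
      fix w assume ab: "r \<le> a" "b \<le> T" and w: "w \<in> tangent_space A (\<gamma> a)"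
      obtain X where X: "parallel a m X" "X a = w" using trans ab w by fastforce
      then have "X m \<in> tangent_space A (\<gamma> m)"
        using trans by (auto simp: parallel_along_def vector_field_along_def)
      then obtain Y where "parallel m b Y" "Y m = X m" using trans ab by fastforce
      from parallel_concat[OF ab(1) trans(3,4) ab(2) X(1) this] X(2) trans
      show "\<exists>X. parallel a b X \<and> X a = w" by fastforce
    qed
  next
    case (local x)
    show ?case
    proof (cases "x \<in> {r..T}")
      case True
      then obtain c where c: "c \<in> charts_at A (\<gamma> x)" using chart_exists by blast
      then obtain e where e: "e > 0" "\<And>\<tau>. \<tau> \<in> {r..T} \<Longrightarrow> dist \<tau> x < e \<Longrightarrow> c \<in> charts_at A (\<gamma> \<tau>)"
        using chart_near[OF True] by blast
      show ?thesis
      proof (intro exI[of _ e] conjI allI impI ballI e(1))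
        fix a b w assume *: "a \<le> x \<and> x \<le> b \<and> b - a < e" "r \<le> a" "b \<le> T"
          and w: "w \<in> tangent_space A (\<gamma> a)"
        then have "\<gamma> s \<in> cdom c" if "s \<in> {a..b}" for s
          using e(2)[of s] that by (auto simp: charts_at_def dist_real_def)
        then show "\<exists>X. parallel a b X \<and> X a = w"
          using * w c by (intro parallel_exists_in_chart[of a b c]) (auto simp: charts_at_def)
      qed
    next
      case False
      then show ?thesis by (intro exI[of _ 1]) auto
    qed
  qed
  then show ?thesis using assms by blast
qed

text \<open>\<open>parallel_unique\<close> makes the definite description meaningful, so any
  parallel field evaluates the transport.\<close>

lemma parallel_transport_eq:
  assumes ab: "r \<le> a" "a \<le> b" "b \<le> T" and X: "parallel a b X"
  shows "parallel_transport A g \<gamma> a b (X a) = X b"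
  unfolding parallel_transport_def
proof (rule the_equality)
  show "\<exists>Y. parallel a b Y \<and> Y a = X a \<and> Y b = X b" using X by blast
next
  fix y assume "\<exists>Y. parallel a b Y \<and> Y a = X a \<and> Y b = y"
  then obtain Y where Y: "parallel a b Y" "Y a = X a" "Y b = y" by blast
  have "b \<in> {a..b}" using ab by simp
  from parallel_unique[OF ab Y(1) X Y(2) this] show "y = X b" unfolding Y(3) .
qed

section \<open>Parallel frames and the average velocity\<close>

text \<open>A combination vanishing at \<open>s\<close> is itself parallel, hence vanishes at
  \<open>r\<close>, where its components in \<open>c0\<close> are its coefficients.\<close>

lemma parallel_frame_exists:
  obtains E :: "'n \<Rightarrow> real \<Rightarrow> ('a, 'n) tangent" where "\<And>i. parallel r T (E i)"
    "\<And>s c. s \<in> {r..T} \<Longrightarrow> c \<in> charts_at A (\<gamma> s) \<Longrightarrow> invertible (\<chi> k i. E i s c $ k)"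
proof -
  have rT': "r \<le> r" "r \<le> T" "T \<le> T" "r \<in> {r..T}" using rT by auto
  obtain c0 where c0: "c0 \<in> charts_at A (\<gamma> r)" using chart_exists[OF rT'(4)] by blast
  have "\<forall>i. \<exists>X. parallel r T X \<and> X r = tangent_of c0 (\<gamma> r) (axis i 1)"
    using parallel_exists[OF rT'(1-3) tangent_of_in[OF c0]] by blast
  then obtain E where E: "\<And>i. parallel r T (E i)"
    "\<And>i. E i r = tangent_of c0 (\<gamma> r) (axis i 1)" by metis
  have "invertible (\<chi> k i. E i s c $ k)" if s: "s \<in> {r..T}" and c: "c \<in> charts_at A (\<gamma> s)" for s c
  proof -
    have "a = 0" if a: "(\<chi> k i. E i s c $ k) *v a = 0" for a
    proof -
      let ?Z = "\<lambda>s c. \<Sum>i\<in>UNIV. a $ i *\<^sub>R E i s c"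
      have Z: "parallel r T ?Z" by (rule parallel_sum[OF rT'(1-3) E(1)])
      then have "?Z s \<in> tangent_space A (\<gamma> s)"
        using s by (simp add: parallel_along_def vector_field_along_def)
      moreover have "?Z s c = 0" using a by (simp add: matrix_columns_mult)
      ultimately have "?Z s = (\<lambda>c. 0)" by (intro tangent_space_eqI[OF _ tangent_space_zero c]) auto
      from parallel_zero[OF rT'(1-3) Z s rT'(4) this] have "?Z r c0 = 0" by meson
      then show "a = 0" by (simp add: E(2) tangent_of_same[OF c0] basis_expansion_axis)
    qed
    then show ?thesis using invertible_left_inverse matrix_left_invertible_ker by blast
  qed
  with E(1) show thesis by (rule that)
qed

lemma frame_coefficients:
  fixes E :: "'n \<Rightarrow> real \<Rightarrow> ('a, 'n) tangent"
  assumes E: "\<And>i. parallel r T (E i)"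
    "\<And>s c. s \<in> {r..T} \<Longrightarrow> c \<in> charts_at A (\<gamma> s) \<Longrightarrow> invertible (\<chi> k i. E i s c $ k)"
    and V: "vector_field_along A {r..T} \<gamma> V" "continuous_along A {r..T} \<gamma> V"
  obtains a :: "real \<Rightarrow> real^'n" where "\<And>i. continuous_on {r..T} (\<lambda>s. a s $ i)"
    "\<And>s. s \<in> {r..T} \<Longrightarrow> V s = (\<lambda>c. \<Sum>i\<in>UNIV. a s $ i *\<^sub>R E i s c)"
proof -
  have rT': "r \<le> r" "r \<le> T" "T \<le> T" using rT by auto
  let ?F = "\<lambda>s c. \<chi> k i. E i s c $ k"
  have "\<exists>a. V s = (\<lambda>c. \<Sum>i\<in>UNIV. a $ i *\<^sub>R E i s c)" if s: "s \<in> {r..T}" for s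
  proof -
    obtain c where c: "c \<in> charts_at A (\<gamma> s)" using chart_exists[OF s] by blast
    let ?a = "matrix_inv (?F s c) *v V s c"
    have "V s = (\<lambda>c. \<Sum>i\<in>UNIV. ?a $ i *\<^sub>R E i s c)"
    proof (rule tangent_space_eqI[OF _ _ c])
      show "V s \<in> tangent_space A (\<gamma> s)" using V(1) s by (simp add: vector_field_along_def)
      show "(\<lambda>c. \<Sum>i\<in>UNIV. ?a $ i *\<^sub>R E i s c) \<in> tangent_space A (\<gamma> s)"
        using E(1) s by (intro tangent_space_sum) (auto simp: parallel_along_def vector_field_along_def)
      have "V s c = ?F s c *v ?a"
        by (simp add: matrix_vector_mul_assoc matrix_inv_inverse E(2)[OF s c])
      then show "V s c = (\<Sum>i\<in>UNIV. ?a $ i *\<^sub>R E i s c)"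
        unfolding matrix_columns_mult .
    qed
    then show ?thesis by blast
  qed
  then have "\<exists>a. \<forall>s\<in>{r..T}. V s = (\<lambda>c. \<Sum>i\<in>UNIV. a s $ i *\<^sub>R E i s c)"
    by (intro bchoice ballI)
  then obtain a where a: "\<And>s. s \<in> {r..T} \<Longrightarrow> V s = (\<lambda>c. \<Sum>i\<in>UNIV. a s $ i *\<^sub>R E i s c)"
    by blast
  \<comment> \<open>The coefficients do not depend on the chart used to compute them. Near a given
    time one fixed chart therefore shows their continuity.\<close>
  have a_eq: "a s = matrix_inv (?F s c) *v V s c" if s: "s \<in> {r..T}" and c: "c \<in> charts_at A (\<gamma> s)" for s c
  proof -
    have "V s c = ?F s c *v a s" unfolding matrix_columns_mult by (rule fun_cong[OF a[OF s]])
    then show ?thesis by (simp add: matrix_vector_mul_assoc matrix_inv_inverse E(2)[OF s c])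
  qed
  have "continuous_on {r..T} (\<lambda>s. a s $ i)" for i
    unfolding continuous_on_eq_continuous_within
  proof
    fix s assume s: "s \<in> {r..T}"
    obtain c where c: "c \<in> charts_at A (\<gamma> s)" using chart_exists[OF s] by blast
    then have A: "c \<in> A" by (simp add: charts_at_def)
    let ?S = "{s \<in> {r..T}. \<gamma> s \<in> cdom c}"
    have cE: "continuous_on ?S (\<lambda>s. E i s c $ k)" for i k
    proof -
      have ce: "continuous (at s within {r..T}) (\<lambda>s. E i s c)" if "s \<in> {r..T}" "c \<in> charts_at A (\<gamma> s)" for s
        using E(1)[of i] that unfolding parallel_iff[OF rT']
        by (blast intro: has_vector_derivative_continuous)
      have "continuous_on ?S (\<lambda>s. E i s c)"
        unfolding continuous_on_eq_continuous_within
      proof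
        fix s assume "s \<in> ?S"
        then show "continuous (at s within ?S) (\<lambda>s. E i s c)"
          using A by (intro continuous_within_subset[OF ce, of s ?S]) (auto simp: charts_at_def)
      qed
      then show ?thesis by (intro continuous_intros)
    qed
    have inv: "continuous_on ?S (\<lambda>s. matrix_inv (?F s c) $ k $ l)" for k l
      by (rule continuous_on_matrix_inv) (use cE E(2) A in \<open>auto simp: charts_at_def\<close>)
    have "continuous_on ?S (\<lambda>s. V s c)" using V(2) A by (simp add: continuous_along_def)
    then have cV: "continuous_on ?S (\<lambda>s. V s c $ l)" for l by (intro continuous_intros)
    have "continuous_on ?S (\<lambda>s. (matrix_inv (?F s c) *v V s c) $ i)"
      unfolding matrix_vector_mult_def vec_lambda_beta
      by (intro continuous_on_sum continuous_on_mult inv cV)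
    then have "continuous_on ?S (\<lambda>s. a s $ i)"
      by (rule continuous_on_eq) (use a_eq[of _ c] A in \<open>auto simp: charts_at_def\<close>)
    moreover have "s \<in> ?S" using s c by (simp add: charts_at_def)
    \<comment> \<open>The times spent in a chart are relatively open, so the restriction to them
      does not affect continuity at \<open>s\<close>.\<close>
    moreover have "at s within ?S = at s within {r..T}"
    proof -
      obtain W where W: "open W" "?S = {r..T} \<inter> W"
        using openin_chart_times[OF A] unfolding openin_open by blast
      then have "s \<in> W" using \<open>s \<in> ?S\<close> by blast
      then show ?thesis by (rule at_within_nhd[OF _ W(1)]) (use W(2) in blast)
    qed
    ultimately show "continuous (at s within {r..T}) (\<lambda>s. a s $ i)"
      by (metis continuous_on_eq_continuous_within)
  qed
  with a show thesis by (rule that[rotated])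
qed

text \<open>All transported vectors lie over \<open>\<gamma> s\<close>, and \<open>E i s\<close>
  does not depend on the integration variable, so it leaves the integral. At \<open>s = r\<close>
  both sides are 0, by the convention for division by 0.\<close>

lemma average_velocity_frame:
  fixes E :: "'n \<Rightarrow> real \<Rightarrow> ('a, 'n) tangent"
  assumes E: "\<And>i. parallel r T (E i)" and a: "\<And>i. continuous_on {r..T} (\<lambda>\<tau>. a \<tau> $ i)"
    and v: "\<And>\<tau>. \<tau> \<in> {r..T} \<Longrightarrow> v (\<gamma> \<tau>) \<tau> = (\<lambda>c. \<Sum>i\<in>UNIV. a \<tau> $ i *\<^sub>R E i \<tau> c)"
    and s: "s \<in> {r..T}"
  shows "average_velocity A g \<gamma> v r s
    = (\<lambda>c. \<Sum>i\<in>UNIV. (integral {r..s} (\<lambda>\<tau>. a \<tau> $ i) / (s - r)) *\<^sub>R E i s c)"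
proof
  fix c
  have pt: "parallel_transport A g \<gamma> \<tau> s (v (\<gamma> \<tau>) \<tau>) = (\<lambda>c. \<Sum>i\<in>UNIV. a \<tau> $ i *\<^sub>R E i s c)"
    if \<tau>: "\<tau> \<in> {r..s}" for \<tau>
  proof -
    have rs: "r \<le> \<tau>" "\<tau> \<le> s" "s \<le> T" and \<tau>': "\<tau> \<in> {r..T}" using \<tau> s by auto
    have "parallel \<tau> s (\<lambda>s c. \<Sum>i\<in>UNIV. a \<tau> $ i *\<^sub>R E i s c)"
      by (intro parallel_sum[OF rs] parallel_subinterval[OF E]) (use rs in auto)
    from parallel_transport_eq[OF rs this] show ?thesis unfolding v[OF \<tau>'] .
  qed
  have "((\<lambda>\<tau>. a \<tau> $ i) has_integral integral {r..s} (\<lambda>\<tau>. a \<tau> $ i)) {r..s}" for i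
    using s by (intro integrable_integral integrable_continuous_real continuous_on_subset[OF a]) auto
  then have "((\<lambda>\<tau>. \<Sum>i\<in>UNIV. a \<tau> $ i *\<^sub>R E i s c) has_integral
      (\<Sum>i\<in>UNIV. integral {r..s} (\<lambda>\<tau>. a \<tau> $ i) *\<^sub>R E i s c)) {r..s}"
    by (intro has_integral_sum has_integral_scaleR_left) auto
  then have "integral {r..s} (\<lambda>\<tau>. \<Sum>i\<in>UNIV. a \<tau> $ i *\<^sub>R E i s c)
      = (\<Sum>i\<in>UNIV. integral {r..s} (\<lambda>\<tau>. a \<tau> $ i) *\<^sub>R E i s c)"
    by (rule integral_unique)
  moreover have "integral {r..s} (\<lambda>\<tau>. parallel_transport A g \<gamma> \<tau> s (v (\<gamma> \<tau>) \<tau>) c)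
      = integral {r..s} (\<lambda>\<tau>. \<Sum>i\<in>UNIV. a \<tau> $ i *\<^sub>R E i s c)"
    by (intro integral_cong) (simp add: pt)
  ultimately show "average_velocity A g \<gamma> v r s c
      = (\<Sum>i\<in>UNIV. (integral {r..s} (\<lambda>\<tau>. a \<tau> $ i) / (s - r)) *\<^sub>R E i s c)"
    by (simp add: average_velocity_def scaleR_sum_right)
qed

lemma average_velocity_covariant_derivative:
  assumes t: "r < t" "t \<le> T"
    and V: "vector_field_along A {r..T} \<gamma> (\<lambda>\<tau>. v (\<gamma> \<tau>) \<tau>)"
      "continuous_along A {r..T} \<gamma> (\<lambda>\<tau>. v (\<gamma> \<tau>) \<tau>)"
  shows "average_velocity A g \<gamma> v r t \<in> tangent_space A (\<gamma> t)"
    and "has_covariant_derivative A g {r..T} \<gamma> (average_velocity A g \<gamma> v r)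
      (\<lambda>c. (1 / (t - r)) *\<^sub>R (v (\<gamma> t) t c - average_velocity A g \<gamma> v r t c)) t"
proof -
  have rT': "r \<le> r" "r \<le> T" "T \<le> T" and tT: "t \<in> {r..T}" using t by auto
  obtain E :: "'n \<Rightarrow> real \<Rightarrow> ('a, 'n) tangent" where E: "\<And>i. parallel r T (E i)"
    "\<And>s c. s \<in> {r..T} \<Longrightarrow> c \<in> charts_at A (\<gamma> s) \<Longrightarrow> invertible (\<chi> k i. E i s c $ k)"
    by (rule parallel_frame_exists) blast
  obtain a where a: "\<And>i. continuous_on {r..T} (\<lambda>s. a s $ i)"
    "\<And>s. s \<in> {r..T} \<Longrightarrow> v (\<gamma> s) s = (\<lambda>c. \<Sum>i\<in>UNIV. a s $ i *\<^sub>R E i s c)"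
    by (rule frame_coefficients[OF E V]) blast+
  let ?u = "average_velocity A g \<gamma> v r"
  \<comment> \<open>The value at \<open>s = r\<close> is 0 and need not be the limit of the means;
    the derivative is taken at \<open>t > r\<close>.\<close>
  define \<alpha> where "\<alpha> s i = integral {r..s} (\<lambda>\<tau>. a \<tau> $ i) / (s - r)" for s i
  have u: "?u s = (\<lambda>c. \<Sum>i\<in>UNIV. \<alpha> s i *\<^sub>R E i s c)" if "s \<in> {r..T}" for s
    unfolding \<alpha>_def
    by (intro average_velocity_frame[where E = E and a = a and v = v and s = s] E(1) a that)
  have Evf: "vector_field_along A {r..T} \<gamma> (E i)" for i
    using E(1) by (simp add: parallel_along_def)
  have uvf: "vector_field_along A {r..T} \<gamma> ?u"
    using vector_field_sum[of UNIV "{r..T}" E \<alpha>] Evf u by (simp add: vector_field_along_def)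
  then show ut: "?u t \<in> tangent_space A (\<gamma> t)" using tT by (simp add: vector_field_along_def)
  obtain c where c: "c \<in> charts_at A (\<gamma> t)" using chart_exists[OF tT] by blast
  let ?D = "\<lambda>c. (1 / (t - r)) *\<^sub>R (v (\<gamma> t) t c - ?u t c)"
  have \<alpha>': "((\<lambda>s. \<alpha> s i) has_real_derivative (a t $ i - \<alpha> t i) / (t - r)) (at t within {r..T})" for i
  proof -
    have "((\<lambda>s. integral {r..s} (\<lambda>\<tau>. a \<tau> $ i)) has_real_derivative a t $ i) (at t within {r..T})"
      by (rule integral_has_real_derivative[OF a(1) tT])
    then have "((\<lambda>s. \<alpha> s i) has_real_derivative
        (a t $ i * (t - r) - integral {r..t} (\<lambda>\<tau>. a \<tau> $ i) * 1) / ((t - r) * (t - r))) (at t within {r..T})"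
      unfolding \<alpha>_def using t by (intro DERIV_divide) (auto intro!: derivative_eq_intros)
    moreover have "(a t $ i * (t - r) - integral {r..t} (\<lambda>\<tau>. a \<tau> $ i) * 1) / ((t - r) * (t - r))
        = (a t $ i - \<alpha> t i) / (t - r)"
      using t by (simp add: \<alpha>_def field_simps)
    ultimately show ?thesis by simp
  qed
  show "has_covariant_derivative A g {r..T} \<gamma> ?u ?D t"
  proof (rule has_covariant_derivativeI[OF rT'(1) rT rT'(3) tT c uvf])
    have "v (\<gamma> t) t \<in> tangent_space A (\<gamma> t)" using V tT by (simp add: vector_field_along_def)
    from tangent_space_lincomb[OF this ut, of "1 / (t - r)" "- (1 / (t - r))"]
    show "?D \<in> tangent_space A (\<gamma> t)" by (simp add: scaleR_diff_right)
    let ?\<Gamma> = "christoffel_form c (coord c (\<gamma> t)) (vel c t)"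
    have "((\<lambda>s. E i s c) has_vector_derivative - ?\<Gamma> (E i t c)) (at t within {r..T})" for i
      using E(1)[of i] tT c by (simp add: parallel_iff[OF rT'])
    then have "((\<lambda>s. \<Sum>i\<in>UNIV. \<alpha> s i *\<^sub>R E i s c) has_vector_derivative
        (\<Sum>i\<in>UNIV. \<alpha> t i *\<^sub>R - ?\<Gamma> (E i t c) + ((a t $ i - \<alpha> t i) / (t - r)) *\<^sub>R E i t c))
        (at t within {r..T})"
      by (intro has_vector_derivative_sum has_vector_derivative_scaleR \<alpha>') auto
    then have "((\<lambda>s. ?u s c) has_vector_derivative
        (\<Sum>i\<in>UNIV. \<alpha> t i *\<^sub>R - ?\<Gamma> (E i t c) + ((a t $ i - \<alpha> t i) / (t - r)) *\<^sub>R E i t c))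
        (at t within {r..T})"
      by (rule has_vector_derivative_transform[OF tT, rotated]) (simp add: u)
    \<comment> \<open>By linearity, the terms from the parallel equations of the frame add up to the
      connection term of u; the terms with derivatives of \<open>\<alpha>\<close> remain and form
      \<open>?D\<close>.\<close>
    moreover have "(\<Sum>i\<in>UNIV. \<alpha> t i *\<^sub>R - ?\<Gamma> (E i t c) + ((a t $ i - \<alpha> t i) / (t - r)) *\<^sub>R E i t c)
        = ?D c - ?\<Gamma> (?u t c)"
      unfolding u[OF tT] a(2)[OF tT] christoffel_form_sum
      by (simp add: sum.distrib sum_negf sum_subtractf[symmetric] scaleR_sum_right diff_divide_distrib
          scaleR_diff_left scaleR_diff_right)
    ultimately show "((\<lambda>s. ?u s c) has_vector_derivative ?D c - ?\<Gamma> (?u t c)) (at t within {r..T})"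
      by simp
  qed
qed

end

theorem proposition3p1:
  fixes M :: "'a topology"
    and A :: "('a, 'n::finite) chart set"
    and g :: "('a, 'n) metric"
    and \<gamma> :: "real \<Rightarrow> 'a"
    and v :: "'a \<Rightarrow> real \<Rightarrow> ('a, 'n) tangent"
    and r t T :: real
  assumes "riemannian_manifold M A g"
    and "r < t" and "t \<le> T"
    and "smooth_trajectory M A {r..T} \<gamma>"
    and "vector_field_along A {r..T} \<gamma> (\<lambda>\<tau>. v (\<gamma> \<tau>) \<tau>)"
    and "continuous_along A {r..T} \<gamma> (\<lambda>\<tau>. v (\<gamma> \<tau>) \<tau>)"
  shows "average_velocity A g \<gamma> v r t \<in> tangent_space A (\<gamma> t) \<and>
    (\<exists>D. has_covariant_derivative A g {r..T} \<gamma> (average_velocity A g \<gamma> v r) D t) \<and>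
    average_velocity A g \<gamma> v r t = (\<lambda>c. v (\<gamma> t) t c -
      (t - r) *\<^sub>R covariant_derivative A g {r..T} \<gamma> (average_velocity A g \<gamma> v r) t c)"
proof -
  interpret riemannian_trajectory M A g \<gamma> r T
    using assms by unfold_locales auto
  let ?u = "average_velocity A g \<gamma> v r"
  let ?D = "\<lambda>c. (1 / (t - r)) *\<^sub>R (v (\<gamma> t) t c - ?u t c)"
  note u = average_velocity_covariant_derivative[of t v, OF assms(2,3,5,6)]
  \<comment> \<open>Once the definite description is identified with \<open>?D\<close>, the factor
    \<open>t - r\<close> cancels and the identity is immediate.\<close>
  have "covariant_derivative A g {r..T} \<gamma> ?u t = ?D"
    unfolding covariant_derivative_def
  proof (rule the_equality)
    show "has_covariant_derivative A g {r..T} \<gamma> ?u ?D t" by (rule u(2))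
  next
    fix D assume "has_covariant_derivative A g {r..T} \<gamma> ?u D t"
    from this u(2) show "D = ?D" by (rule has_covariant_derivative_unique) (use assms in auto)
  qed
  with u assms show ?thesis by auto
qed

end
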